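(* Consider LinUCB run for $T$ rounds on the unit ball $\mathcal B^d$ with exploration parameter $\beta$, under the sub-Gaussian noise assumption described in the context. With probability at least $1-\frac1{\log T}$, the estimation error of the ridge estimators $\overline{\boldsymbol\theta}_t$, measured in the norm of the cumulative covariance matrix $\boldsymbol\Lambda_t$, satisfies $$\max_{1\le t\le T}\left\|\overline{\boldsymbol\theta}_t-\boldsymbol\theta^\star\right\|_{\boldsymbol\Lambda_t}\ \lesssim\ \sigma\sqrt{d+\log\log T}+1.$$
   Context: Setting. Let $d\ge 2$, let $T\ge 3$ be the horizon, and let $\boldsymbol\theta^\star\in\mathbb R^d$ with $\|\boldsymbol\theta^\star\|_2=1$. In each round $t=1,\dots,T$ the learner picks an action $\boldsymbol a_t$ in the unit ball $\mathcal B^d=\{\boldsymbol x\in\mathbb R^d:\|\boldsymbol x\|_2\le 1\}$ (every vector of the ball is available in every round) and observes $r_t=\langle\boldsymbol a_t,\boldsymbol\theta^\star\rangle+\epsilon_t$. With $\mathcal F_t=\sigma(\boldsymbol a_1,r_1,\dots,\boldsymbol a_t,r_t)$, the noise satisfies $\mathbb E[\epsilon_t\mid\mathcal F_{t-1}]=0$, $\mathrm{Var}[\epsilon_t\mid\mathcal F_{t-1}]=\sigma^2$, and $\mathbb E[\exp(\lambda\epsilon_t)\mid\mathcal F_{t-1}]\le\exp(\sigma^2\lambda^2/2)$ for all $\lambda\in\mathbb R$ and $t\ge1$, where $\sigma>0$. LinUCB with deterministic exploration parameter $\beta>0$: $\boldsymbol\Lambda_0=\boldsymbol I_d$, $\boldsymbol\Lambda_t=\boldsymbol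 I_d+\sum_{s=1}^t\boldsymbol a_s\boldsymbol a_s^\top$, ridge estimator $\overline{\boldsymbol\theta}_t=\boldsymbol\Lambda_t^{-1}\sum_{s=1}^t\boldsymbol a_s r_s$, projected estimator $\widehat{\boldsymbol\theta}_t=\overline{\boldsymbol\theta}_t/\|\overline{\boldsymbol\theta}_t\|_2$ (an arbitrary unit vector if $\overline{\boldsymbol\theta}_t=0$, e.g. at $t=0$), and $$\boldsymbol a_t\in\arg\max_{\boldsymbol a\in\mathcal B^d}\Big\{\langle\boldsymbol a,\widehat{\boldsymbol\theta}_{t-1}\rangle+\beta\sqrt{\boldsymbol a^\top\boldsymbol\Lambda_{t-1}^{-1}\boldsymbol a}\Big\}.$$ Notation: $\|\boldsymbol x\|_{\boldsymbol\Lambda}=\sqrt{\boldsymbol x^\top\boldsymbol\Lambda\boldsymbol x}$. $f\lesssim g$ means $|f|\le c_1|g|$ for a constant $c_1>0$ that does not depend on $T$. *)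

theory Defs
  imports "HOL-Probability.Probability"
begin

definition outer :: "real ^ 'd \<Rightarrow> real ^ 'd ^ 'd" where
  "outer x = (\<chi> i j. x $ i * x $ j)"

definition mat_norm :: "real ^ 'd ^ 'd \<Rightarrow> real ^ 'd \<Rightarrow> real" where
  "mat_norm A x = sqrt (x \<bullet> (A *v x))"

text \<open>Sample-path quantities: \<open>a\<close> and \<open>r\<close> are one realised sequence of actions and rewards,
  indexed from round 1 (index 0 is unused).\<close>

definition design :: "(nat \<Rightarrow> real ^ 'd) \<Rightarrow> nat \<Rightarrow> real ^ 'd ^ 'd" where
  "design a t = mat 1 + (\<Sum>s\<in>{1..t}. outer (a s))"

definition ridge :: "(nat \<Rightarrow> real ^ 'd) \<Rightarrow> (nat \<Rightarrow> real) \<Rightarrow> nat \<Rightarrow> real ^ 'd" where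
  "ridge a r t = matrix_inv (design a t) *v (\<Sum>s\<in>{1..t}. r s *\<^sub>R a s)"

text \<open>A relation rather than a function: every unit vector is admissible when the ridge
  estimator vanishes.\<close>

definition is_projected :: "real ^ 'd \<Rightarrow> real ^ 'd \<Rightarrow> bool" where
  "is_projected x h \<longleftrightarrow> (if x = 0 then norm h = 1 else h = x /\<^sub>R norm x)"

definition ucb_index :: "real \<Rightarrow> real ^ 'd \<Rightarrow> real ^ 'd ^ 'd \<Rightarrow> real ^ 'd \<Rightarrow> real" where
  "ucb_index \<beta> h A x = x \<bullet> h + \<beta> * mat_norm (matrix_inv A) x"

definition reward ::
    "real ^ 'd \<Rightarrow> (nat \<Rightarrow> 'w \<Rightarrow> real ^ 'd) \<Rightarrow> (nat \<Rightarrow> 'w \<Rightarrow> real) \<Rightarrow> nat \<Rightarrow> 'w \<Rightarrow> real" where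
  "reward \<theta> a \<epsilon> t \<omega> = a t \<omega> \<bullet> \<theta> + \<epsilon> t \<omega>"

text \<open>The sigma-algebra generated by the actions and rewards of rounds 1 to \<open>t\<close>
  (trivial for \<open>t = 0\<close>).\<close>

definition history ::
    "'w measure \<Rightarrow> (nat \<Rightarrow> 'w \<Rightarrow> real ^ 'd) \<Rightarrow> (nat \<Rightarrow> 'w \<Rightarrow> real) \<Rightarrow> nat \<Rightarrow> 'w measure" where
  "history M a r t =
     vimage_algebra (space M) (\<lambda>\<omega>. \<lambda>s\<in>{1..t}. (a s \<omega>, r s \<omega>)) (\<Pi>\<^sub>M s\<in>{1..t}. borel)"

definition cond_var :: "'w measure \<Rightarrow> 'w measure \<Rightarrow> ('w \<Rightarrow> real) \<Rightarrow> 'w \<Rightarrow> real" where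
  "cond_var M F X = real_cond_exp M F (\<lambda>\<omega>. (X \<omega> - real_cond_exp M F X \<omega>)\<^sup>2)"

text \<open>A \<open>T\<close>-round run of LinUCB. The process \<open>h\<close> is the projected estimator. Actions are
  required to be predictable, i.e. the choices left open by the argmax and by a vanishing ridge
  estimator must not look at the noise of the current round. The integrability
  assumptions are needed because \<open>real_cond_exp\<close> is total, so an inequality
  for it does not by itself say that the conditional expectation exists.\<close>

locale linucb_ball = prob_space M for M :: "'w measure" +
  fixes \<theta> :: "real ^ 'd" and \<sigma> \<beta> :: real and T :: nat
    and a h :: "nat \<Rightarrow> 'w \<Rightarrow> real ^ 'd" and \<epsilon> :: "nat \<Rightarrow> 'w \<Rightarrow> real"
  assumes norm_theta: "norm \<theta> = 1"
    and noise_measurable: "\<And>t. t \<in> {1..T} \<Longrightarrow> \<epsilon> t \<in> borel_measurable M"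
    and noise_integrable: "\<And>t. t \<in> {1..T} \<Longrightarrow> integrable M (\<epsilon> t)"
    and noise_exp_integrable:
      "\<And>t l. t \<in> {1..T} \<Longrightarrow> integrable M (\<lambda>\<omega>. exp (l * \<epsilon> t \<omega>))"
    and noise_mean: "\<And>t. t \<in> {1..T} \<Longrightarrow>
      AE \<omega> in M. real_cond_exp M (history M a (reward \<theta> a \<epsilon>) (t - 1)) (\<epsilon> t) \<omega> = 0"
    and noise_var: "\<And>t. t \<in> {1..T} \<Longrightarrow>
      AE \<omega> in M. cond_var M (history M a (reward \<theta> a \<epsilon>) (t - 1)) (\<epsilon> t) \<omega> = \<sigma>\<^sup>2"
    and noise_subgaussian: "\<And>t l. t \<in> {1..T} \<Longrightarrow>
      AE \<omega> in M. real_cond_exp M (history M a (reward \<theta> a \<epsilon>) (t - 1))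
        (\<lambda>\<omega>. exp (l * \<epsilon> t \<omega>)) \<omega> \<le> exp (\<sigma>\<^sup>2 * l\<^sup>2 / 2)"
    and action_predictable: "\<And>t. t \<in> {1..T} \<Longrightarrow>
      a t \<in> borel_measurable (history M a (reward \<theta> a \<epsilon>) (t - 1))"
    and estimator: "\<And>t \<omega>. t < T \<Longrightarrow> \<omega> \<in> space M \<Longrightarrow>
      is_projected (ridge (\<lambda>s. a s \<omega>) (\<lambda>s. reward \<theta> a \<epsilon> s \<omega>) t) (h t \<omega>)"
    and action: "\<And>t \<omega>. t \<in> {1..T} \<Longrightarrow> \<omega> \<in> space M \<Longrightarrow>
      is_arg_max (ucb_index \<beta> (h (t - 1) \<omega>) (design (\<lambda>s. a s \<omega>) (t - 1)))
        (\<lambda>x. x \<in> cball 0 1) (a t \<omega>)"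

end

theory Submission imports Defs begin

text \<open>
  The error is at most \<open>W t + 1\<close>, where \<open>W t\<close> is the norm of the score \<open>S t = (\<Sum>s\<le>t. \<epsilon> s a s)\<close>
  in the inverse of the design matrix \<open>D t\<close>, and \<open>W t\<close> is controlled by the exponential supermartingales
  of \<open>l \<bullet> S t\<close> for \<open>l\<close> in a finite deterministic net. The logarithm of the size of the net
  enters the bound, so one needs \<open>D t\<close> to be known in advance up to powers of \<open>ln T\<close>; the net then has
  polylogarithmic size. Two properties of LinUCB provide this. First, whatever the noise,
  the exploration bonus forces the least eigenvalue \<open>\<mu>\<close> of the design to be at least of order
  \<open>sqrt t / ln T\<close>, because every bonus is at least of order \<open>1 / \<mu>\<close> while the determinant, which
  collects the squared bonuses, is polynomial in \<open>t\<close>. Second, a coarse net gives \<open>W t\<^sup>2 \<lesssim> ln T\<close>, hence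
  all actions lie within about \<open>t\<^bsup>-1/4\<^esup>\<close> of \<open>\<theta>\<close>, and \<open>D t\<close> is comparable to \<open>t \<theta>\<theta>\<^sup>T + sqrt t I\<close>.
\<close>

section \<open>Positive definite matrices and their determinants\<close>

text \<open>A bound through ln det \<open>D t\<close> would only give W^2 of order ln T, because the
  determinant grows like a power of t. Here the supremum over rounds is free, by the maximal
  inequality for supermartingales, and only the number of directions \<open>l\<close> is paid for;
  the failure probability 1 / ln T alone already contributes ln ln T. A finite net must come close
  to the optimal \<open>l\<close>, so its radius has to be known beforehand although the noise is
  unbounded. Hence there are three nets, each preparing the next: signed coordinate vectors bound
  the norm of \<open>S t\<close> linearly in T, this is the radius of the coarse grid, and the bound
  from that grid fixes radius and shape of the last grids. The latter depend on
  \<open>\<theta>\<close>, which is admissible because \<open>\<theta>\<close> is deterministic.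
  Powers of ln T lost on the way are harmless, since they end up inside a logarithm. The final
  constant depends on the dimension, \<open>\<sigma>\<close> and \<open>\<beta>\<close>; it is
  chosen before T, \<open>\<theta>\<close> and the probability space.\<close>

definition above_id :: "real ^ 'd ^ 'd \<Rightarrow> bool" where
  "above_id A \<longleftrightarrow> transpose A = A \<and> (\<forall>v. v \<bullet> v \<le> v \<bullet> (A *v v))"

lemma above_id_sym:
  assumes "above_id A"
  shows "u \<bullet> (A *v v) = (A *v u) \<bullet> v"
  using assms unfolding above_id_def
  by (metis dot_lmul_matrix transpose_matrix_vector)

lemma above_id_ge: "above_id A \<Longrightarrow> v \<bullet> v \<le> v \<bullet> (A *v v)"
  by (simp add: above_id_def)

lemma above_id_nonneg: "above_id A \<Longrightarrow> 0 \<le> v \<bullet> (A *v v)"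
  using above_id_ge[of A v] inner_ge_zero[of v] by linarith

lemma above_id_pos: "above_id A \<Longrightarrow> v \<noteq> 0 \<Longrightarrow> 0 < v \<bullet> (A *v v)"
  using above_id_ge[of A v] by (smt (verit) inner_gt_zero_iff)

lemma above_id_invertible:
  assumes "above_id A"
  shows "invertible A"
proof -
  have "A *v v = 0 \<Longrightarrow> v = 0" for v
    using above_id_pos[OF assms, of v] by auto
  then show ?thesis
    by (simp add: invertible_left_inverse matrix_left_invertible_ker)
qed

lemma above_id_inv_mult:
  assumes "above_id A"
  shows "A *v (matrix_inv A *v b) = b" "matrix_inv A *v (A *v b) = b"
proof -
  have "A ** matrix_inv A = mat 1 \<and> matrix_inv A ** A = mat 1"
    using above_id_invertible[OF assms] unfolding matrix_inv_def invertible_def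
    by (rule someI_ex)
  then show "A *v (matrix_inv A *v b) = b" "matrix_inv A *v (A *v b) = b"
    by (simp_all add: matrix_vector_mul_assoc)
qed

lemma above_id_Cauchy_Schwarz:
  assumes "above_id A"
  shows "(u \<bullet> (A *v v))\<^sup>2 \<le> (u \<bullet> (A *v u)) * (v \<bullet> (A *v v))"
proof (cases "v = 0")
  case False
  let ?p = "v \<bullet> (A *v v)" and ?c = "u \<bullet> (A *v v)"
  have p: "?p > 0" using above_id_pos[OF assms False] .
  have c: "v \<bullet> (A *v u) = ?c"
    using above_id_sym[OF assms, of u v] by (simp add: inner_commute)
  have "0 \<le> (u - (?c / ?p) *\<^sub>R v) \<bullet> (A *v (u - (?c / ?p) *\<^sub>R v))"
    by (rule above_id_nonneg[OF assms])
  also have "\<dots> = u \<bullet> (A *v u) - ?c\<^sup>2 / ?p"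
    using p by (simp add: matrix_vector_mult_diff_distrib matrix_vector_mult_scaleR
        inner_diff_left inner_diff_right c power2_eq_square field_simps)
  finally show ?thesis using p by (simp add: field_simps)
qed simp

section \<open>The norms of a matrix above the identity and of its inverse\<close>

lemma mat_norm_nonneg: "above_id A \<Longrightarrow> 0 \<le> mat_norm A x"
  by (simp add: mat_norm_def above_id_nonneg)

lemma mat_norm_sq: "above_id A \<Longrightarrow> (mat_norm A x)\<^sup>2 = x \<bullet> (A *v x)"
  by (simp add: mat_norm_def above_id_nonneg)

lemma mat_norm_Cauchy_Schwarz:
  assumes "above_id A"
  shows "\<bar>u \<bullet> (A *v v)\<bar> \<le> mat_norm A u * mat_norm A v"
  using above_id_Cauchy_Schwarz[OF assms, of u v]
  unfolding mat_norm_def real_sqrt_mult[symmetric] by (metis real_sqrt_abs real_sqrt_le_mono)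

lemma mat_norm_triangle:
  assumes "above_id A"
  shows "mat_norm A (x + y) \<le> mat_norm A x + mat_norm A y"
proof (rule power2_le_imp_le)
  have "y \<bullet> (A *v x) = x \<bullet> (A *v y)"
    using above_id_sym[OF assms, of x y] by (simp add: inner_commute)
  then have "(mat_norm A (x + y))\<^sup>2 = (mat_norm A x)\<^sup>2 + 2 * (x \<bullet> (A *v y)) + (mat_norm A y)\<^sup>2"
    by (simp add: mat_norm_sq[OF assms] matrix_vector_right_distrib inner_add_left inner_add_right)
  also have "\<dots> \<le> (mat_norm A x + mat_norm A y)\<^sup>2"
    using mat_norm_Cauchy_Schwarz[OF assms, of x y] by (simp add: power2_sum)
  finally show "(mat_norm A (x + y))\<^sup>2 \<le> (mat_norm A x + mat_norm A y)\<^sup>2" .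
  show "0 \<le> mat_norm A x + mat_norm A y"
    by (simp add: mat_norm_nonneg[OF assms])
qed

lemma mat_norm_minus: "mat_norm A (- x) = mat_norm A x"
  using matrix_vector_mult_scaleR[of A "-1" x] by (simp add: mat_norm_def)

lemma mat_norm_inv:
  assumes "above_id A"
  shows "mat_norm (matrix_inv A) x = mat_norm A (matrix_inv A *v x)"
  unfolding mat_norm_def above_id_inv_mult(1)[OF assms] by (simp add: inner_commute)

lemma mat_norm_inv_triangle:
  assumes "above_id A"
  shows "mat_norm (matrix_inv A) (x + y) \<le> mat_norm (matrix_inv A) x + mat_norm (matrix_inv A) y"
  by (simp add: mat_norm_inv[OF assms] matrix_vector_right_distrib mat_norm_triangle[OF assms])

lemma mat_norm_inv_sq:
  assumes "above_id A"
  shows "(mat_norm (matrix_inv A) x)\<^sup>2 = x \<bullet> (matrix_inv A *v x)"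
  unfolding mat_norm_inv[OF assms] mat_norm_sq[OF assms] above_id_inv_mult(1)[OF assms]
  by (simp add: inner_commute)

lemma mat_norm_inv_nonneg: "above_id A \<Longrightarrow> 0 \<le> mat_norm (matrix_inv A) x"
  by (simp add: mat_norm_inv mat_norm_nonneg)

text \<open>Duality of the two norms: Cauchy-Schwarz for \<open>A\<close>, applied to
  \<open>u\<close> and \<open>matrix_inv A *v x\<close>.\<close>

lemma inner_le_mat_norm_inv:
  assumes "above_id A"
  shows "\<bar>x \<bullet> u\<bar> \<le> mat_norm (matrix_inv A) x * mat_norm A u"
  using mat_norm_Cauchy_Schwarz[OF assms, of "u" "matrix_inv A *v x"]
  by (simp add: mat_norm_inv[OF assms] above_id_inv_mult(1)[OF assms] inner_commute mult.commute)

text \<open>No diagonalisation is involved. With \<open>y = matrix_inv A *v x\<close> and W its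
  \<open>A\<close>-norm, W^2 = y . x is at most |y| |x|, while the eigenvalue bound gives |y| at
  most W / sqrt l; one factor W cancels.\<close>

lemma mat_norm_inv_le:
  assumes A: "above_id A" and l: "l > 0" and ev: "\<And>v. l * (v \<bullet> v) \<le> v \<bullet> (A *v v)"
  shows "mat_norm (matrix_inv A) x \<le> norm x / sqrt l"
proof -
  define y where "y = matrix_inv A *v x"
  let ?W = "mat_norm A y"
  have W0: "?W \<ge> 0" using mat_norm_nonneg[OF A] .
  have "?W\<^sup>2 = y \<bullet> x"
    unfolding mat_norm_sq[OF A] y_def above_id_inv_mult(1)[OF A] ..
  then have 1: "?W\<^sup>2 \<le> norm y * norm x" using norm_cauchy_schwarz[of y x] by simp
  have "(sqrt l * norm y)\<^sup>2 \<le> ?W\<^sup>2"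
    using ev[of y] l by (simp add: mat_norm_sq[OF A] power_mult_distrib dot_square_norm)
  then have "sqrt l * norm y \<le> ?W" using W0 by (rule power2_le_imp_le)
  then have "norm y \<le> ?W / sqrt l" using l by (simp add: field_simps)
  with 1 have "?W\<^sup>2 \<le> ?W / sqrt l * norm x"
    by (meson order_trans mult_right_mono norm_ge_zero)
  then have "?W * ?W \<le> ?W * (norm x / sqrt l)" by (simp add: power2_eq_square)
  moreover have "0 \<le> norm x / sqrt l" using l by simp
  ultimately have "?W \<le> norm x / sqrt l"
    using W0 by (metis mult_le_cancel_left_pos order_le_less)
  then show ?thesis by (simp add: mat_norm_inv[OF A] y_def)
qed

section \<open>Rank-one updates, the design matrix and its determinant\<close>

lemma outer_mult: "outer x *v v = (x \<bullet> v) *\<^sub>R x"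
  by (simp add: vec_eq_iff outer_def matrix_vector_mult_def inner_vec_def sum_distrib_left
      sum_distrib_right mult_ac)

lemma design_0: "design a 0 = mat 1"
  by (simp add: design_def)

lemma design_Suc: "design a (Suc t) = design a t + outer (a (Suc t))"
  by (simp add: design_def add.assoc)

lemma design_mult: "design a t *v v = v + (\<Sum>s\<in>{1..t}. (a s \<bullet> v) *\<^sub>R a s)"
  by (induction t) (simp_all add: design_0 design_Suc matrix_vector_mult_add_rdistrib outer_mult)

lemma design_quad: "v \<bullet> (design a t *v v) = v \<bullet> v + (\<Sum>s\<in>{1..t}. (a s \<bullet> v)\<^sup>2)"
  by (simp add: design_mult inner_add_right inner_sum_right power2_eq_square inner_commute)

lemma transpose_design: "transpose (design a t) = design a t"
  by (induction t)
    (simp_all add: design_0 design_Suc, simp_all add: vec_eq_iff transpose_def outer_def mult.commute)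

lemma above_id_design: "above_id (design a t)"
  unfolding above_id_def design_quad transpose_design by (simp add: sum_nonneg)

lemma design_quad_mono:
  "s \<le> t \<Longrightarrow> v \<bullet> (design a s *v v) \<le> v \<bullet> (design a t *v v)"
  unfolding design_quad by (simp add: sum_mono2)

text \<open>Rotating \<open>y\<close> onto a coordinate axis leaves a matrix that differs from the identity in a
  single column, whose determinant is given by Cramer's rule.\<close>

lemma det_id_plus_rank_one:
  fixes x y :: "real ^ 'd"
  shows "det (mat 1 + (\<chi> i j. x $ i * y $ j)) = 1 + x \<bullet> y"
proof -
  obtain k :: 'd where True by blast
  define e where "e = norm y *\<^sub>R (axis k 1 :: real ^ 'd)"
  have "norm e = norm y" by (simp add: e_def)
  then obtain f where f: "orthogonal_transformation f" "f y = e"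
    using orthogonal_transformation_exists[of y e] by metis
  define P where "P = matrix f"
  have P: "P ** transpose P = mat 1" "transpose P ** P = mat 1"
    using f(1) unfolding P_def orthogonal_transformation_matrix orthogonal_matrix_def by auto
  have Pv: "P *v v = f v" for v
    unfolding P_def using f(1) by (simp add: orthogonal_transformation_def matrix_works)
  let ?R = "\<lambda>x y :: real ^ 'd. (\<chi> i j. x $ i * y $ j) :: real ^ 'd ^ 'd"
  have R: "P ** ?R x y ** transpose P = ?R (P *v x) (P *v y)"
    by (simp add: vec_eq_iff matrix_matrix_mult_def matrix_vector_mult_def transpose_def
        sum_distrib_left sum_distrib_right mult_ac)
  have dist: "(A + B) ** C = A ** C + B ** C" for A B C :: "real ^ 'd ^ 'd"
    by (simp add: vec_eq_iff matrix_matrix_mult_def distrib_right sum.distrib)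
  have "det (mat 1 + ?R x y) = det (P ** (mat 1 + ?R x y) ** transpose P)"
  proof -
    have "det P * det (transpose P) = 1" using P(1) det_mul[of P "transpose P"] by simp
    then show ?thesis by (simp add: det_mul)
  qed
  also have "P ** (mat 1 + ?R x y) ** transpose P = mat 1 + ?R (f x) e"
    using R by (simp add: matrix_add_ldistrib dist P Pv f(2))
  also have "mat 1 + ?R (f x) e = (\<chi> i j. if j = k
      then ((mat 1 :: real ^ 'd ^ 'd) *v (axis k 1 + norm y *\<^sub>R f x)) $ i else (mat 1 :: real ^ 'd ^ 'd) $ i $ j)"
    unfolding matrix_vector_mul_lid by (auto simp: vec_eq_iff mat_def e_def axis_def)
  also have "det \<dots> = 1 + norm y * f x $ k"
    by (subst cramer_lemma) simp
  also have "norm y * f x $ k = f x \<bullet> e"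
    by (simp add: e_def inner_axis)
  also have "\<dots> = x \<bullet> y"
    using f by (metis orthogonal_transformation_def)
  finally show ?thesis .
qed

text \<open>Matrix determinant lemma: factoring out \<open>A\<close> leaves the identity plus the
  rank-one matrix with entries \<open>z $ i * x $ j\<close>.\<close>

lemma det_plus_outer:
  assumes "above_id A"
  shows "det (A + outer x) = det A * (1 + (mat_norm (matrix_inv A) x)\<^sup>2)"
proof -
  define z where "z = matrix_inv A *v x"
  have Az: "A *v z = x" by (simp add: z_def above_id_inv_mult(1)[OF assms])
  have "A + outer x = A ** (mat 1 + (\<chi> i j. z $ i * x $ j))"
  proof -
    have "x $ i * x $ j = (\<Sum>k\<in>UNIV. A $ i $ k * (z $ k * x $ j))" for i j
    proof -
      have "x $ i = (\<Sum>k\<in>UNIV. A $ i $ k * z $ k)"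
        by (subst Az[symmetric]) (simp add: matrix_vector_mult_def)
      then show ?thesis by (simp add: sum_distrib_right mult.assoc)
    qed
    then have "outer x = A ** (\<chi> i j. z $ i * x $ j)"
      by (simp add: vec_eq_iff matrix_matrix_mult_def outer_def)
    then show ?thesis by (simp add: matrix_add_ldistrib)
  qed
  then have "det (A + outer x) = det A * (1 + z \<bullet> x)"
    by (simp only: det_mul det_id_plus_rank_one)
  then show ?thesis
    by (simp add: mat_norm_inv_sq[OF assms] z_def inner_commute)
qed

lemma det_design:
  "det (design a t) = (\<Prod>s\<in>{1..t}. 1 + (mat_norm (matrix_inv (design a (s - 1))) (a s))\<^sup>2)"
  by (induction t) (simp_all add: design_0 design_Suc det_plus_outer above_id_design mult.commute)

text \<open>The Leibniz expansion, estimated term by term. The factorial is harmless: only the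
  logarithm of a determinant will enter, with constants that may depend on the dimension.\<close>

lemma abs_det_le:
  fixes A :: "real ^ 'd ^ 'd"
  assumes "\<And>i j. \<bar>A $ i $ j\<bar> \<le> K"
  shows "\<bar>det A\<bar> \<le> fact (CARD('d)) * K ^ CARD('d)"
proof -
  have "\<bar>det A\<bar> \<le> (\<Sum>p | p permutes (UNIV :: 'd set). K ^ CARD('d))"
    unfolding det_def
  proof (rule order_trans[OF sum_abs sum_mono])
    fix p assume "p \<in> {p. p permutes (UNIV :: 'd set)}"
    have "\<bar>of_int (sign p) :: real\<bar> = 1"
      by (simp add: sign_def)
    moreover have "(\<Prod>i\<in>UNIV. \<bar>A $ i $ p i\<bar>) \<le> (\<Prod>i\<in>(UNIV :: 'd set). K)"
      by (rule prod_mono) (simp add: assms)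
    ultimately show "\<bar>of_int (sign p) * (\<Prod>i\<in>UNIV. A $ i $ p i)\<bar> \<le> K ^ CARD('d)"
      by (simp add: abs_mult abs_prod)
  qed
  also have "\<dots> = fact (CARD('d)) * K ^ CARD('d)"
    by (simp add: card_permutations[of UNIV "CARD('d)"])
  finally show ?thesis .
qed

lemma abs_det_design_le:
  fixes a :: "nat \<Rightarrow> real ^ 'd"
  assumes "\<And>s. s \<in> {1..t} \<Longrightarrow> norm (a s) \<le> 1"
  shows "\<bar>det (design a t)\<bar> \<le> fact (CARD('d)) * (1 + real t) ^ CARD('d)"
proof (rule abs_det_le)
  fix i j
  have "\<bar>a s $ i * a s $ j\<bar> \<le> 1" if "s \<in> {1..t}" for s
    using component_le_norm_cart[of "a s" i] component_le_norm_cart[of "a s" j] assms[OF that]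
    by (simp add: abs_mult mult_le_one)
  then have "(\<Sum>s\<in>{1..t}. \<bar>a s $ i * a s $ j\<bar>) \<le> (\<Sum>s\<in>{1..t}. 1)"
    by (rule sum_mono)
  then have "\<bar>\<Sum>s\<in>{1..t}. a s $ i * a s $ j\<bar> \<le> real t"
    using sum_abs[of "\<lambda>s. a s $ i * a s $ j" "{1..t}"] by (simp del: sum_abs)
  moreover have "design a t $ i $ j = (if i = j then 1 else 0) + (\<Sum>s\<in>{1..t}. a s $ i * a s $ j)"
    by (simp add: design_def mat_def outer_def)
  ultimately show "\<bar>design a t $ i $ j\<bar> \<le> 1 + real t"
    by (auto split: if_splits)
qed

section \<open>The geometry of LinUCB actions\<close>

lemma norm_diff_sq_le:
  assumes "norm x \<le> 1" "norm h = 1"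
  shows "(norm (x - h))\<^sup>2 \<le> 2 * (1 - x \<bullet> h)"
proof -
  have "(norm (x - h))\<^sup>2 = (norm x)\<^sup>2 + (norm h)\<^sup>2 - 2 * (x \<bullet> h)"
    by (simp add: power2_norm_eq_inner inner_diff_left inner_diff_right inner_commute)
  moreover have "(norm x)\<^sup>2 \<le> 1" using assms(1) by (simp add: power_le_one)
  ultimately show ?thesis using assms(2) by simp
qed

lemma ucb_action_ge:
  assumes "is_arg_max (ucb_index \<beta> h A) (\<lambda>x. x \<in> cball 0 1) x" "norm y \<le> 1"
  shows "norm x \<le> 1"
    and "y \<bullet> h + \<beta> * mat_norm (matrix_inv A) y \<le> x \<bullet> h + \<beta> * mat_norm (matrix_inv A) x"
  using assms unfolding is_arg_max_def ucb_index_def by (auto simp: not_less)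

text \<open>Playing \<open>h\<close> itself is an alternative, so 1 - x . h is at most
  \<open>\<beta>\<close> times the difference of the bonuses of x and h, hence linear in |x - h|. On
  the ball |x - h|^2 is at most 2 (1 - x . h), and a square dominated by a linear term bounds |x -
  h|.\<close>

lemma ucb_action_near_estimate:
  assumes A: "above_id A" and l: "l > 0" and ev: "\<And>v. l * (v \<bullet> v) \<le> v \<bullet> (A *v v)"
    and \<beta>: "\<beta> > 0" and h: "norm h = 1"
    and x: "is_arg_max (ucb_index \<beta> h A) (\<lambda>x. x \<in> cball 0 1) x"
  shows "norm (x - h) \<le> 2 * \<beta> / sqrt l"
proof -
  let ?N = "mat_norm (matrix_inv A)"
  have x1: "norm x \<le> 1" and fx: "h \<bullet> h + \<beta> * ?N h \<le> x \<bullet> h + \<beta> * ?N x"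
    using ucb_action_ge[OF x, of h] h by auto
  have hh: "h \<bullet> h = 1" using h by (simp add: dot_square_norm)
  have "?N x \<le> ?N h + ?N (x - h)"
    using mat_norm_inv_triangle[OF A, of h "x - h"] by simp
  moreover have "?N (x - h) \<le> norm (x - h) / sqrt l"
    by (rule mat_norm_inv_le[OF A l ev])
  ultimately have "?N x \<le> ?N h + norm (x - h) / sqrt l" by linarith
  from mult_left_mono[OF this, of \<beta>] fx hh \<beta>
  have "1 - x \<bullet> h \<le> \<beta> * (norm (x - h) / sqrt l)"
    by (simp add: distrib_left)
  then have "(norm (x - h))\<^sup>2 \<le> 2 * (\<beta> * (norm (x - h) / sqrt l))"
    using mult_left_mono[of "1 - x \<bullet> h" "\<beta> * (norm (x - h) / sqrt l)" 2] norm_diff_sq_le[OF x1 h]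
    by (meson order_trans zero_le_numeral)
  then have "norm (x - h) * norm (x - h) \<le> norm (x - h) * (2 * \<beta> / sqrt l)"
    by (simp add: power2_eq_square mult_ac)
  then show ?thesis
    using \<beta> l by (cases "x = h") (simp, metis mult_le_cancel_left_pos zero_less_norm_iff right_minus_eq)
qed

text \<open>Compare with the normalised point \<open>h + \<tau> u\<close>, \<open>\<tau> = \<beta> / sqrt (u \<bullet> A u)\<close>, whose index
  is at least \<open>sqrt (1 + \<tau>\<^sup>2)\<close>; the action can only compete through its exploration bonus.\<close>

lemma ucb_bonus_ge:
  assumes A: "above_id A" and \<beta>: "\<beta> > 0" and h: "norm h = 1" and u: "norm u = 1"
    and x: "is_arg_max (ucb_index \<beta> h A) (\<lambda>x. x \<in> cball 0 1) x"
  shows "\<beta> / ((2 + \<beta>) * (u \<bullet> (A *v u))) \<le> mat_norm (matrix_inv A) x"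
proof -
  \<comment> \<open>The sign is chosen so that the cross term in the square of the norm of
    \<open>z\<close> is nonnegative.\<close>
  define v where "v = (if u \<bullet> h \<ge> 0 then u else - u)"
  have v: "norm v = 1" "v \<bullet> h \<ge> 0" "v \<bullet> (A *v v) = u \<bullet> (A *v u)"
    using u matrix_vector_mult_scaleR[of A "-1" u] by (auto simp: v_def)
  define w where "w = v \<bullet> (A *v v)"
  have w1: "w \<ge> 1"
    using above_id_ge[OF A, of v] v(1) by (simp add: w_def dot_square_norm)
  have Nv: "mat_norm A v = sqrt w" by (simp add: mat_norm_def w_def)
  define \<tau> where "\<tau> = \<beta> / sqrt w"
  have \<tau>: "0 < \<tau>" "\<tau> \<le> \<beta>" using w1 \<beta> by (simp_all add: \<tau>_def field_simps)
  define z where "z = h + \<tau> *\<^sub>R v"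
  have nz: "(norm z)\<^sup>2 = 1 + \<tau>\<^sup>2 + 2 * \<tau> * (v \<bullet> h)"
  proof -
    have "h \<bullet> h = 1" "v \<bullet> v = 1" using h v(1) by (simp_all add: dot_square_norm)
    then show ?thesis unfolding z_def power2_norm_eq_inner
      by (simp add: inner_add_left inner_add_right inner_commute power2_eq_square)
  qed
  then have "sqrt (1 + \<tau>\<^sup>2) \<le> norm z"
    using v(2) \<tau> by (intro real_le_lsqrt) simp_all
  moreover have "1 \<le> sqrt (1 + \<tau>\<^sup>2)" by simp
  ultimately have z1: "norm z \<ge> 1" by linarith
  define y where "y = z /\<^sub>R norm z"
  have "norm z \<noteq> 0" using z1 by linarith
  then have y: "norm y \<le> 1" "y \<bullet> z = norm z"
    by (simp_all add: y_def dot_square_norm power2_eq_square)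
  \<comment> \<open>By duality, the scale \<open>\<tau>\<close> makes the bonus of \<open>y\<close>
    worth at least \<open>\<tau> * (y \<bullet> v)\<close>; the index of \<open>y\<close> is then at
    least \<open>y \<bullet> z\<close>, the norm of \<open>z\<close>.\<close>
  have "y \<bullet> v \<le> mat_norm (matrix_inv A) y * sqrt w"
    using inner_le_mat_norm_inv[OF A, of y v] unfolding Nv by (rule abs_le_D1)
  then have "\<tau> * (y \<bullet> v) \<le> \<tau> * (mat_norm (matrix_inv A) y * sqrt w)"
    using \<tau> by simp
  also have "\<dots> = \<beta> * mat_norm (matrix_inv A) y"
    using w1 by (simp add: \<tau>_def)
  finally have "norm z \<le> y \<bullet> h + \<beta> * mat_norm (matrix_inv A) y"
    using y(2) by (simp add: z_def inner_add_right)
  with ucb_action_ge(2)[OF x y(1)]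
  have "norm z \<le> x \<bullet> h + \<beta> * mat_norm (matrix_inv A) x" by simp
  moreover have "x \<bullet> h \<le> 1"
    using norm_cauchy_schwarz[of x h] ucb_action_ge(1)[OF x, of 0] h by simp
  ultimately have b: "sqrt (1 + \<tau>\<^sup>2) - 1 \<le> \<beta> * mat_norm (matrix_inv A) x"
    using \<open>sqrt (1 + \<tau>\<^sup>2) \<le> norm z\<close> by linarith
  have s: "sqrt (1 + \<tau>\<^sup>2) \<le> 1 + \<tau>"
    using \<tau> by (intro real_le_lsqrt) (simp_all add: power2_sum)
  \<comment> \<open>The gain sqrt (1 + \<open>\<tau>\<close>^2) - 1 is of second order in
    \<open>\<tau>\<close>. The conjugate factor is at most 2 + \<open>\<tau>\<close>, hence at most
    2 + \<open>\<beta>\<close>, which is the constant in the statement.\<close>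
  have "\<tau>\<^sup>2 = (sqrt (1 + \<tau>\<^sup>2) - 1) * (sqrt (1 + \<tau>\<^sup>2) + 1)"
    by (simp add: algebra_simps)
  also have "\<dots> \<le> (sqrt (1 + \<tau>\<^sup>2) - 1) * (2 + \<beta>)"
    using s \<tau> by (intro mult_left_mono) simp_all
  finally have "\<tau>\<^sup>2 \<le> (\<beta> * mat_norm (matrix_inv A) x) * (2 + \<beta>)"
    using b \<beta> by (smt (verit) mult_right_mono)
  moreover have "\<tau>\<^sup>2 = \<beta>\<^sup>2 / w" using w1 by (simp add: \<tau>_def power_divide)
  ultimately have "\<beta> * (\<beta> / w) \<le> \<beta> * (mat_norm (matrix_inv A) x * (2 + \<beta>))"
    by (simp add: power2_eq_square mult_ac)
  then have "\<beta> / w \<le> mat_norm (matrix_inv A) x * (2 + \<beta>)"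
    using \<beta> by (simp only: mult_le_cancel_left_pos)
  then have "\<beta> / w / (2 + \<beta>) \<le> mat_norm (matrix_inv A) x"
    using \<beta> by (subst pos_divide_le_eq) simp_all
  then show ?thesis
    using v(3) by (simp add: w_def mult.commute)
qed

text \<open>Normalising moves \<open>x\<close> by the gap between its norm and 1, which is at most
  its distance to the unit vector \<open>\<theta>\<close>; so the error at most doubles. If
  \<open>x = 0\<close>, that distance is 1, and any two unit vectors are at most 2 apart.\<close>

lemma is_projected_error:
  assumes "is_projected x h" "norm \<theta> = 1"
  shows "norm h = 1" "norm (h - \<theta>) \<le> 2 * norm (x - \<theta>)"
proof -
  show h: "norm h = 1" using assms(1) by (auto simp: is_projected_def split: if_splits)
  show "norm (h - \<theta>) \<le> 2 * norm (x - \<theta>)"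
  proof (cases "x = 0")
    case True
    then show ?thesis using norm_triangle_ineq4[of h \<theta>] h assms(2) by simp
  next
    case False
    then have "h = x /\<^sub>R norm x" using assms(1) by (simp add: is_projected_def)
    then have "x = norm x *\<^sub>R h" using False by simp
    then have "h - x = (1 - norm x) *\<^sub>R h" by (simp add: scaleR_diff_left)
    then have "norm (h - x) = \<bar>norm \<theta> - norm x\<bar>"
      using h assms(2) by simp
    also have "\<dots> \<le> norm (x - \<theta>)"
      using norm_triangle_ineq3[of \<theta> x] by (simp add: norm_minus_commute)
    finally show ?thesis using norm_triangle_ineq[of "h - x" "x - \<theta>"] by simp
  qed
qed

section \<open>Sample paths of LinUCB\<close>

text \<open>Separates the deterministic part of the argument from probability: \<open>e\<close> is
  an arbitrary real sequence. The projected estimator is quantified anew in each round, so no choice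
  of it has to be tracked.\<close>

definition ucb_path ::
    "real \<Rightarrow> real ^ 'd \<Rightarrow> nat \<Rightarrow> (nat \<Rightarrow> real ^ 'd) \<Rightarrow> (nat \<Rightarrow> real) \<Rightarrow> bool" where
  "ucb_path \<beta> \<theta> T a e \<longleftrightarrow> norm \<theta> = 1 \<and> (\<forall>t\<in>{1..T}. \<exists>h.
     is_projected (ridge a (\<lambda>s. a s \<bullet> \<theta> + e s) (t - 1)) h \<and>
     is_arg_max (ucb_index \<beta> h (design a (t - 1))) (\<lambda>x. x \<in> cball 0 1) (a t))"

lemma ucb_path_norm_le:
  assumes "ucb_path \<beta> \<theta> T a e" "t \<in> {1..T}"
  shows "norm (a t) \<le> 1"
  using assms unfolding ucb_path_def is_arg_max_def by auto

abbreviation score :: "(nat \<Rightarrow> real ^ 'd) \<Rightarrow> (nat \<Rightarrow> real) \<Rightarrow> nat \<Rightarrow> real ^ 'd" where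
  "score a e t \<equiv> \<Sum>s\<in>{1..t}. e s *\<^sub>R a s"

text \<open>The error splits into the noise part, the inverse design applied to the score, and the
  regularisation bias, the inverse design applied to \<open>\<theta>\<close>. The bias has norm at
  most 1 because the design dominates the identity; this is the source of the additive 1 in the
  theorem.\<close>

lemma ridge_error_le:
  assumes "norm \<theta> = 1"
  shows "mat_norm (design a t) (ridge a (\<lambda>s. a s \<bullet> \<theta> + e s) t - \<theta>)
    \<le> mat_norm (matrix_inv (design a t)) (score a e t) + 1"
proof -
  let ?D = "design a t"
  note A = above_id_design[of a t]
  have "(\<Sum>s\<in>{1..t}. (a s \<bullet> \<theta> + e s) *\<^sub>R a s) = ?D *v \<theta> - \<theta> + score a e t"
    by (simp add: design_mult scaleR_add_left sum.distrib)
  then have eq: "ridge a (\<lambda>s. a s \<bullet> \<theta> + e s) t - \<theta>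
      = matrix_inv ?D *v (score a e t) + - (matrix_inv ?D *v \<theta>)"
    by (simp add: ridge_def matrix_vector_right_distrib matrix_vector_mult_diff_distrib
        above_id_inv_mult(2)[OF A])
  have "mat_norm (matrix_inv ?D) \<theta> \<le> norm \<theta> / sqrt 1"
    by (rule mat_norm_inv_le[OF A]) (simp_all add: above_id_ge[OF A])
  then show ?thesis
    unfolding eq using mat_norm_triangle[OF A] assms
    by (smt (verit) mat_norm_inv[OF A] mat_norm_minus real_sqrt_one div_by_1)
qed

lemma ln_ge_1:
  assumes "T \<ge> 3" shows "ln (real T) \<ge> 1"
proof -
  have "exp 1 \<le> real T" using exp_le assms by linarith
  then show ?thesis using assms by (subst ln_ge_iff) simp_all
qed

text \<open>The determinant grows by the factor \<open>1 + bonus\<^sup>2\<close> in each round but only polynomially overall,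
  and by \<open>ucb_bonus_ge\<close> a small eigenvalue would make all these factors large.\<close>

lemma ucb_path_min_eigenvalue:
  fixes \<beta> :: real
  assumes \<beta>: "\<beta> > 0"
  shows "\<exists>c>0. \<forall>T\<ge>3. \<forall>(\<theta> :: real ^ 'd) a e t v. ucb_path \<beta> \<theta> T a e \<longrightarrow> t \<le> T \<longrightarrow>
    c * sqrt (real t + 1) / ln (real T) * (v \<bullet> v) \<le> v \<bullet> (design a t *v v)"
proof -
  define d where "d = CARD('d)"
  have d: "d \<ge> 1" by (simp add: d_def)
  define b where "b = \<beta> / (2 + \<beta>)"
  have b: "0 < b" "b \<le> 1" using \<beta> by (simp_all add: b_def)
  \<comment> \<open>\<open>E * ln T\<close> will bound the logarithm of the determinant, through ln
    (1 + t) at most 2 ln T. The constant \<open>c\<close> below comes from solving the resulting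
    inequality for \<open>w\<close>, with ln (1 + y) at least y / 2 on [0,1] and t + 1 at most 2
    t.\<close>
  define E where "E = ln (fact d) + 2 * real d"
  have lnf: "0 \<le> ln (fact d :: real)" by (rule ln_ge_zero) (rule fact_ge_1)
  have E: "E \<ge> 2" using d lnf unfolding E_def by linarith
  define c where "c = b / (2 * sqrt E)"
  have c: "c > 0" using b E by (simp add: c_def)
  have "1 \<le> sqrt E" using E by simp
  then have c1: "c \<le> 1" using b unfolding c_def by (subst divide_le_eq_1_pos) linarith+
  have main: "c * sqrt (real t + 1) / ln (real T) \<le> u \<bullet> (design a t *v u)"
    if T: "T \<ge> 3" and p: "ucb_path \<beta> \<theta> T a e" and t: "t \<le> T" and u: "norm u = 1"
    for T and \<theta> :: "real ^ 'd" and a e t u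
  proof -
    define L where "L = ln (real T)"
    have L: "L \<ge> 1" using ln_ge_1[OF T] by (simp add: L_def)
    define w where "w = u \<bullet> (design a t *v u)"
    have w1: "w \<ge> 1"
      using above_id_ge[OF above_id_design, of u a t] u by (simp add: w_def dot_square_norm)
    show ?thesis
    proof (cases "t = 0")
      case True
      have "c / L \<le> 1" using c1 L c by simp
      then show ?thesis using w1 by (simp add: True L_def w_def)
    next
      case False
      have "1 + (b / w)\<^sup>2 \<le> 1 + (mat_norm (matrix_inv (design a (s - 1))) (a s))\<^sup>2"
        if s: "s \<in> {1..t}" for s
      proof -
        obtain h where h: "is_projected (ridge a (\<lambda>s. a s \<bullet> \<theta> + e s) (s - 1)) h"
            "is_arg_max (ucb_index \<beta> h (design a (s - 1))) (\<lambda>x. x \<in> cball 0 1) (a s)"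
          using p s t unfolding ucb_path_def by (meson atLeastAtMost_iff le_trans)
        have "norm h = 1" using h(1) p is_projected_error(1) unfolding ucb_path_def by blast
        note ge = ucb_bonus_ge[OF above_id_design \<beta> this u h(2)]
        \<comment> \<open>The quadratic form only grows with time, so its final value
          \<open>w\<close> bounds all earlier bonuses from below.\<close>
        have "u \<bullet> (design a (s - 1) *v u) \<le> w"
          unfolding w_def using s by (intro design_quad_mono) auto
        moreover have "1 \<le> u \<bullet> (design a (s - 1) *v u)"
          using above_id_ge[OF above_id_design, of u a "s - 1"] u by (simp add: dot_square_norm)
        ultimately have "b / w \<le> b / (u \<bullet> (design a (s - 1) *v u))"
          using b by (simp add: frac_le)
        also have "\<dots> \<le> mat_norm (matrix_inv (design a (s - 1))) (a s)"
          using ge by (simp add: b_def)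
        finally show ?thesis using b w1 by (simp add: power_mono)
      qed
      then have "(\<Prod>s\<in>{1..t}. 1 + (b / w)\<^sup>2) \<le> det (design a t)"
        unfolding det_design by (intro prod_mono) simp
      also have "\<dots> \<le> fact d * (1 + real t) ^ d"
        using abs_det_design_le[of t a] ucb_path_norm_le[OF p] t unfolding d_def
        by (smt (verit) atLeastAtMost_iff le_trans)
      finally have le: "(1 + (b / w)\<^sup>2) ^ t \<le> fact d * (1 + real t) ^ d" by simp
      have pos: "1 + (b / w)\<^sup>2 > 0" by (simp add: add_pos_nonneg)
      have lnT: "ln (1 + real t) \<le> 2 * L"
      proof -
        have "1 + real t \<le> real T * 3" using t T by linarith
        also have "\<dots> \<le> real T ^ 2" using T by (simp add: power2_eq_square)
        finally have "ln (1 + real t) \<le> ln (real T ^ 2)"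
          by (subst ln_le_cancel_iff) (use T in auto)
        then show ?thesis using T by (simp add: ln_realpow L_def)
      qed
      have "real t * ln (1 + (b / w)\<^sup>2) = ln ((1 + (b / w)\<^sup>2) ^ t)"
        using pos by (simp add: ln_realpow)
      also have "\<dots> \<le> ln (fact d * (1 + real t) ^ d)"
        using le pos by (subst ln_le_cancel_iff) simp_all
      also have "\<dots> = ln (fact d) + real d * ln (1 + real t)"
        by (simp add: ln_mult ln_realpow)
      also have "\<dots> \<le> ln (fact d) + real d * (2 * L)"
        using lnT by (intro add_left_mono mult_left_mono) simp_all
      also have "ln (fact d) + real d * (2 * L) \<le> E * L"
      proof -
        have "ln (fact d :: real) * 1 \<le> ln (fact d) * L" using L lnf by (intro mult_left_mono) auto
        then show ?thesis by (simp add: E_def algebra_simps)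
      qed
      finally have 1: "real t * ln (1 + (b / w)\<^sup>2) \<le> E * L" by simp
      have x1: "(b / w)\<^sup>2 \<le> 1" using b w1 by (simp add: power_le_one)
      have "(b / w)\<^sup>2 / 2 \<le> ln (1 + (b / w)\<^sup>2)"
      proof -
        have "ln (inverse (1 + (b / w)\<^sup>2)) \<le> inverse (1 + (b / w)\<^sup>2) - 1"
          by (rule ln_le_minus_one) (use pos in simp)
        then have "1 - inverse (1 + (b / w)\<^sup>2) \<le> ln (1 + (b / w)\<^sup>2)"
          using pos by (simp add: ln_inverse)
        moreover have "(b / w)\<^sup>2 / 2 \<le> 1 - inverse (1 + (b / w)\<^sup>2)"
        proof -
          have "y / 2 \<le> 1 - inverse (1 + y)" if "0 \<le> y" "y \<le> 1" for y :: real
            using that mult_left_mono[OF that(2,1)] by (simp add: field_simps)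
          then show ?thesis using x1 by simp
        qed
        ultimately show ?thesis by linarith
      qed
      with 1 have "real t * ((b / w)\<^sup>2 / 2) \<le> E * L"
        by (smt (verit) mult_left_mono of_nat_0_le_iff)
      then have "real t * b\<^sup>2 \<le> 2 * E * L * w\<^sup>2"
        using w1 by (simp add: power_divide field_simps)
      \<comment> \<open>Giving away a factor \<open>L\<close> here makes the right-hand side a
        square, so that the bound on \<open>w\<close> contains \<open>L\<close> and not its
        root.\<close>
      also have "\<dots> \<le> 2 * E * L\<^sup>2 * w\<^sup>2"
        using L E by (intro mult_right_mono mult_left_mono) (simp_all add: power2_eq_square)
      finally have "(real t + 1) * b\<^sup>2 \<le> 4 * E * L\<^sup>2 * w\<^sup>2"
        using False mult_right_mono[of "real t + 1" "2 * real t" "b\<^sup>2"] by simp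
      then have "(b * sqrt (real t + 1))\<^sup>2 \<le> (2 * sqrt E * L * w)\<^sup>2"
        using E by (simp add: power_mult_distrib mult_ac)
      then have "b * sqrt (real t + 1) \<le> 2 * sqrt E * L * w"
        by (rule power2_le_imp_le) (use E L w1 in simp)
      then show ?thesis
        using E L by (simp add: c_def L_def[symmetric] w_def[symmetric] field_simps)
    qed
  qed
  have "c * sqrt (real t + 1) / ln (real T) * (v \<bullet> v) \<le> v \<bullet> (design a t *v v)"
    if T: "T \<ge> 3" and p: "ucb_path \<beta> \<theta> T a e" and t: "t \<le> T"
    for T and \<theta> v :: "real ^ 'd" and a e t
  proof (cases "v = 0")
    case False
    define u where "u = v /\<^sub>R norm v"
    have u: "norm u = 1" "v = norm v *\<^sub>R u" using False by (simp_all add: u_def)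
    have "v \<bullet> (design a t *v v) = (norm v)\<^sup>2 * (u \<bullet> (design a t *v u))"
      by (subst (1 2) u(2)) (simp add: matrix_vector_mult_scaleR power2_eq_square)
    then show ?thesis
      using mult_left_mono[OF main[OF T p t u(1)], of "(norm v)\<^sup>2"]
      by (simp add: dot_square_norm mult_ac)
  qed simp
  then show ?thesis using c by blast
qed

lemma sum_inverse_sqrt_le: "(\<Sum>s\<in>{1..t}. 1 / sqrt (real s)) \<le> 2 * sqrt (real t)"
proof (induction t)
  case (Suc t)
  have "1 / sqrt (real (Suc t)) \<le> 2 * (sqrt (real (Suc t)) - sqrt (real t))"
  proof -
    have "1 = (sqrt (real (Suc t)) - sqrt (real t)) * (sqrt (real (Suc t)) + sqrt (real t))"
      by (simp add: algebra_simps)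
    also have "\<dots> \<le> (sqrt (real (Suc t)) - sqrt (real t)) * (2 * sqrt (real (Suc t)))"
      by (intro mult_left_mono) simp_all
    finally show ?thesis by (simp add: field_simps)
  qed
  with Suc show ?case by simp
qed simp

text \<open>The least eigenvalue l of the design before round s is of order sqrt s / ln T. Both the
  distance from the action to the projected estimator and that from the estimator to
  \<open>\<theta>\<close> are at most of order B / sqrt l, so the squared deviation is of order B^2
  ln T / sqrt s, which sums to sqrt t.\<close>

lemma ucb_path_deviation:
  fixes \<beta> :: real
  assumes \<beta>: "\<beta> > 0"
  shows "\<exists>C>0. \<forall>T\<ge>3. \<forall>(\<theta> :: real ^ 'd) a e t B. ucb_path \<beta> \<theta> T a e \<longrightarrow> t \<le> T \<longrightarrow> B \<ge> 1 \<longrightarrow>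
    (\<forall>t\<le>T. mat_norm (design a t) (ridge a (\<lambda>s. a s \<bullet> \<theta> + e s) t - \<theta>) \<le> B) \<longrightarrow>
    (\<Sum>s\<in>{1..t}. (norm (a s - \<theta>))\<^sup>2) \<le> C * B\<^sup>2 * ln (real T) * sqrt (real t)"
proof -
  obtain c where c: "c > 0" and min: "\<And>T (\<theta> :: real ^ 'd) a e t v. T \<ge> 3 \<Longrightarrow>
      ucb_path \<beta> \<theta> T a e \<Longrightarrow> t \<le> T \<Longrightarrow>
      c * sqrt (real t + 1) / ln (real T) * (v \<bullet> v) \<le> v \<bullet> (design a t *v v)"
    using ucb_path_min_eigenvalue[OF \<beta>, where 'd = 'd] by metis
  define C where "C = 8 * (1 + \<beta>)\<^sup>2 / c"
  have C: "C > 0" using c \<beta> by (simp add: C_def add_pos_pos)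
  have "(\<Sum>s\<in>{1..t}. (norm (a s - \<theta>))\<^sup>2) \<le> C * B\<^sup>2 * ln (real T) * sqrt (real t)"
    if T: "T \<ge> 3" and p: "ucb_path \<beta> \<theta> T a e" and t: "t \<le> T" and B: "B \<ge> 1"
      and err: "\<And>t. t \<le> T \<Longrightarrow> mat_norm (design a t) (ridge a (\<lambda>s. a s \<bullet> \<theta> + e s) t - \<theta>) \<le> B"
    for T and \<theta> :: "real ^ 'd" and a e t B
  proof -
    define L where "L = ln (real T)"
    have L: "L \<ge> 1" using ln_ge_1[OF T] by (simp add: L_def)
    have th: "norm \<theta> = 1" using p by (simp add: ucb_path_def)
    have "(norm (a s - \<theta>))\<^sup>2 \<le> 4 * (1 + \<beta>)\<^sup>2 * B\<^sup>2 * L / c * (1 / sqrt (real s))"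
      if s: "s \<in> {1..t}" for s
    proof -
      obtain h where h: "is_projected (ridge a (\<lambda>s. a s \<bullet> \<theta> + e s) (s - 1)) h"
          "is_arg_max (ucb_index \<beta> h (design a (s - 1))) (\<lambda>x. x \<in> cball 0 1) (a s)"
        using p s t unfolding ucb_path_def by (meson atLeastAtMost_iff le_trans)
      \<comment> \<open>Round \<open>s\<close> sees the design of round \<open>s - 1\<close>. The
        shift \<open>real t + 1\<close> in the eigenvalue bound turns this into sqrt s, including
        the first round.\<close>
      define l where "l = c * sqrt (real s) / L"
      have l: "l > 0" using c L s by (simp add: l_def)
      have ev: "l * (v \<bullet> v) \<le> v \<bullet> (design a (s - 1) *v v)" for v
      proof -
        have "s - 1 \<le> T" using s t by auto
        moreover have "real (s - 1) + 1 = real s" using s by auto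
        ultimately show ?thesis using min[OF T p, of "s - 1" v] by (simp add: l_def L_def)
      qed
      have n1: "norm (a s - h) \<le> 2 * \<beta> / sqrt l"
        by (rule ucb_action_near_estimate[OF above_id_design l ev \<beta> is_projected_error(1)[OF h(1) th] h(2)])
      define g where "g = ridge a (\<lambda>s. a s \<bullet> \<theta> + e s) (s - 1) - \<theta>"
      have "sqrt (l * (g \<bullet> g)) \<le> mat_norm (design a (s - 1)) g"
        unfolding mat_norm_def using ev by simp
      also have "\<dots> \<le> B" using err[of "s - 1"] s t by (auto simp: g_def)
      finally have "norm g \<le> B / sqrt l"
        using l by (simp add: real_sqrt_mult norm_eq_sqrt_inner field_simps)
      then have n2: "norm (h - \<theta>) \<le> 2 * B / sqrt l"
        using is_projected_error(2)[OF h(1) th] by (simp add: g_def)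
      have "norm (a s - \<theta>) \<le> norm (a s - h) + norm (h - \<theta>)"
        using norm_triangle_ineq[of "a s - h" "h - \<theta>"] by simp
      also have "\<dots> \<le> 2 * (\<beta> + B) / sqrt l"
        using n1 n2 by (simp add: add_divide_distrib distrib_left)
      also have "\<dots> \<le> 2 * ((1 + \<beta>) * B) / sqrt l"
        using B \<beta> l by (intro divide_right_mono mult_left_mono) (simp_all add: algebra_simps)
      finally have "(norm (a s - \<theta>))\<^sup>2 \<le> (2 * ((1 + \<beta>) * B) / sqrt l)\<^sup>2"
        by (rule power_mono) simp
      also have "\<dots> = 4 * (1 + \<beta>)\<^sup>2 * B\<^sup>2 / l"
        using l by (simp add: power_divide power_mult_distrib)
      also have "\<dots> = 4 * (1 + \<beta>)\<^sup>2 * B\<^sup>2 * L / c * (1 / sqrt (real s))"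
        by (simp add: l_def)
      finally show ?thesis .
    qed
    then have "(\<Sum>s\<in>{1..t}. (norm (a s - \<theta>))\<^sup>2)
        \<le> (\<Sum>s\<in>{1..t}. 4 * (1 + \<beta>)\<^sup>2 * B\<^sup>2 * L / c * (1 / sqrt (real s)))"
      by (rule sum_mono)
    also have "\<dots> = 4 * (1 + \<beta>)\<^sup>2 * B\<^sup>2 * L / c * (\<Sum>s\<in>{1..t}. 1 / sqrt (real s))"
      by (simp only: sum_distrib_left)
    also have "\<dots> \<le> 4 * (1 + \<beta>)\<^sup>2 * B\<^sup>2 * L / c * (2 * sqrt (real t))"
      using c L by (intro mult_left_mono sum_inverse_sqrt_le) simp
    finally show ?thesis by (simp add: C_def L_def mult_ac)
  qed
  then show ?thesis using C by blast
qed

lemma sq_sum_le: "(x + y)\<^sup>2 \<le> 2 * x\<^sup>2 + 2 * (y::real)\<^sup>2"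
  using zero_le_power2[of "x - y"] by (simp add: power2_eq_square algebra_simps)

text \<open>Replacing each \<open>a s \<bullet> v\<close> by \<open>\<theta> \<bullet> v\<close>
  costs a factor 2 and the summed squared deviations, which are of order B^2 ln T sqrt t |v|^2. This
  gives a deterministic model of the random design matrix, up to powers of ln T when
  \<open>B\<close> is such a power.\<close>

lemma ucb_path_design_comparable:
  fixes \<beta> :: real
  assumes \<beta>: "\<beta> > 0"
  shows "\<exists>C>0. \<forall>T\<ge>3. \<forall>(\<theta> :: real ^ 'd) a e B. ucb_path \<beta> \<theta> T a e \<longrightarrow> B \<ge> 1 \<longrightarrow>
    (\<forall>t\<le>T. mat_norm (design a t) (ridge a (\<lambda>s. a s \<bullet> \<theta> + e s) t - \<theta>) \<le> B) \<longrightarrow>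
    (\<forall>t\<in>{1..T}. \<forall>v.
      v \<bullet> (design a t *v v)
        \<le> C * B\<^sup>2 * ln (real T) * (real t * (\<theta> \<bullet> v)\<^sup>2 + sqrt (real t) * (v \<bullet> v)) \<and>
      real t * (\<theta> \<bullet> v)\<^sup>2 + sqrt (real t) * (v \<bullet> v)
        \<le> C * B\<^sup>2 * (ln (real T))\<^sup>2 * (v \<bullet> (design a t *v v)))"
proof -
  obtain c where c: "c > 0" and min: "\<And>T (\<theta> :: real ^ 'd) a e t v. T \<ge> 3 \<Longrightarrow>
      ucb_path \<beta> \<theta> T a e \<Longrightarrow> t \<le> T \<Longrightarrow>
      c * sqrt (real t + 1) / ln (real T) * (v \<bullet> v) \<le> v \<bullet> (design a t *v v)"
    using ucb_path_min_eigenvalue[OF \<beta>, where 'd = 'd] by metis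
  obtain C1 where C1: "C1 > 0" and dev: "\<And>T (\<theta> :: real ^ 'd) a e t B. T \<ge> 3 \<Longrightarrow>
      ucb_path \<beta> \<theta> T a e \<Longrightarrow> t \<le> T \<Longrightarrow> B \<ge> 1 \<Longrightarrow>
      (\<forall>t\<le>T. mat_norm (design a t) (ridge a (\<lambda>s. a s \<bullet> \<theta> + e s) t - \<theta>) \<le> B) \<Longrightarrow>
      (\<Sum>s\<in>{1..t}. (norm (a s - \<theta>))\<^sup>2) \<le> C1 * B\<^sup>2 * ln (real T) * sqrt (real t)"
    using ucb_path_deviation[OF \<beta>, where 'd = 'd]
    by (elim exE conjE) (rule that, assumption, blast)
  define C where "C = 3 + 2 * C1 + 2 * C1 / c + 1 / c"
  have C: "C > 0" using c C1 by (simp add: C_def add_pos_pos)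
  have "v \<bullet> (design a t *v v)
        \<le> C * B\<^sup>2 * ln (real T) * (real t * (\<theta> \<bullet> v)\<^sup>2 + sqrt (real t) * (v \<bullet> v)) \<and>
      real t * (\<theta> \<bullet> v)\<^sup>2 + sqrt (real t) * (v \<bullet> v)
        \<le> C * B\<^sup>2 * (ln (real T))\<^sup>2 * (v \<bullet> (design a t *v v))"
    if T: "T \<ge> 3" and p: "ucb_path \<beta> \<theta> T a e" and t: "t \<in> {1..T}" and B: "B \<ge> 1"
      and err: "\<forall>t\<le>T. mat_norm (design a t) (ridge a (\<lambda>s. a s \<bullet> \<theta> + e s) t - \<theta>) \<le> B"
    for T and \<theta> v :: "real ^ 'd" and a e t B
  proof -
    define L where "L = ln (real T)"
    have L: "L \<ge> 1" using ln_ge_1[OF T] by (simp add: L_def)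
    have BL: "1 \<le> B\<^sup>2 * L" "1 \<le> B\<^sup>2 * L\<^sup>2" "L \<le> B\<^sup>2 * L\<^sup>2"
    proof -
      have B2: "1 \<le> B\<^sup>2" and L2: "L \<le> L\<^sup>2" "1 \<le> L\<^sup>2"
        using B L by (simp_all add: power2_eq_square mult_ge1_I)
      show "1 \<le> B\<^sup>2 * L" "1 \<le> B\<^sup>2 * L\<^sup>2" using B2 L L2 by (simp_all add: mult_ge1_I)
      show "L \<le> B\<^sup>2 * L\<^sup>2" using mult_mono[OF B2 L2(1)] L by simp
    qed
    define K where "K = C1 * B\<^sup>2 * L"
    have K0: "K \<ge> 0" using C1 L by (simp add: K_def)
    define D where "D = v \<bullet> (design a t *v v)"
    define X where "X = real t * (\<theta> \<bullet> v)\<^sup>2"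
    define Y where "Y = sqrt (real t) * (v \<bullet> v)"
    have t1: "1 \<le> sqrt (real t)" using t by simp
    have X0: "X \<ge> 0" and Y0: "Y \<ge> 0" by (simp_all add: X_def Y_def)
    have vY: "v \<bullet> v \<le> Y" using mult_right_mono[OF t1, of "v \<bullet> v"] by (simp add: Y_def)
    have D0: "D \<ge> 0" unfolding D_def by (rule above_id_nonneg[OF above_id_design])
    have "(\<Sum>s\<in>{1..t}. ((a s - \<theta>) \<bullet> v)\<^sup>2) \<le> (\<Sum>s\<in>{1..t}. (norm (a s - \<theta>))\<^sup>2 * (v \<bullet> v))"
      by (intro sum_mono) (metis Cauchy_Schwarz_ineq power2_norm_eq_inner)
    also have "\<dots> = (\<Sum>s\<in>{1..t}. (norm (a s - \<theta>))\<^sup>2) * (v \<bullet> v)"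
      by (simp only: sum_distrib_right)
    also have "\<dots> \<le> K * sqrt (real t) * (v \<bullet> v)"
      using dev[OF T p _ B err, of t] t by (intro mult_right_mono) (simp_all add: K_def L_def)
    finally have S: "(\<Sum>s\<in>{1..t}. ((a s - \<theta>) \<bullet> v)\<^sup>2) \<le> K * Y" by (simp add: Y_def mult.assoc)
    have "(\<Sum>s\<in>{1..t}. (a s \<bullet> v)\<^sup>2) \<le> (\<Sum>s\<in>{1..t}. 2 * (\<theta> \<bullet> v)\<^sup>2 + 2 * ((a s - \<theta>) \<bullet> v)\<^sup>2)"
    proof (rule sum_mono)
      fix s
      show "(a s \<bullet> v)\<^sup>2 \<le> 2 * (\<theta> \<bullet> v)\<^sup>2 + 2 * ((a s - \<theta>) \<bullet> v)\<^sup>2"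
        using sq_sum_le[of "\<theta> \<bullet> v" "(a s - \<theta>) \<bullet> v"] by (simp add: inner_diff_left)
    qed
    also have "\<dots> = 2 * X + 2 * (\<Sum>s\<in>{1..t}. ((a s - \<theta>) \<bullet> v)\<^sup>2)"
      by (simp add: sum.distrib X_def flip: sum_distrib_left)
    finally have "D \<le> v \<bullet> v + 2 * X + 2 * (K * Y)"
      using S unfolding D_def design_quad by linarith
    also have "\<dots> \<le> (3 + 2 * K) * (X + Y)"
      using vY X0 Y0 mult_nonneg_nonneg[OF K0 X0] by (simp add: algebra_simps)
    also have "\<dots> \<le> (C * B\<^sup>2 * L) * (X + Y)"
    proof (rule mult_right_mono)
      have "3 + 2 * K \<le> (3 + 2 * C1) * (B\<^sup>2 * L)"
        using BL(1) by (simp add: K_def algebra_simps)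
      also have "\<dots> \<le> C * (B\<^sup>2 * L)"
        using c C1 BL(1) by (intro mult_right_mono) (simp_all add: C_def)
      finally show "3 + 2 * K \<le> C * B\<^sup>2 * L" by (simp add: mult.assoc)
    qed (use X0 Y0 in simp)
    finally have up: "D \<le> C * B\<^sup>2 * L * (X + Y)" .
    have "X = (\<Sum>s\<in>{1..t}. (\<theta> \<bullet> v)\<^sup>2)" by (simp add: X_def)
    also have "\<dots> \<le> (\<Sum>s\<in>{1..t}. 2 * (a s \<bullet> v)\<^sup>2 + 2 * ((a s - \<theta>) \<bullet> v)\<^sup>2)"
    proof (rule sum_mono)
      fix s
      show "(\<theta> \<bullet> v)\<^sup>2 \<le> 2 * (a s \<bullet> v)\<^sup>2 + 2 * ((a s - \<theta>) \<bullet> v)\<^sup>2"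
        using sq_sum_le[of "a s \<bullet> v" "\<theta> \<bullet> v - a s \<bullet> v"]
        by (simp add: inner_diff_left power2_commute)
    qed
    also have "\<dots> = 2 * (\<Sum>s\<in>{1..t}. (a s \<bullet> v)\<^sup>2) + 2 * (\<Sum>s\<in>{1..t}. ((a s - \<theta>) \<bullet> v)\<^sup>2)"
      by (simp add: sum.distrib flip: sum_distrib_left)
    finally have X: "X \<le> 2 * D + 2 * (K * Y)"
      using S inner_ge_zero[of v] unfolding D_def design_quad by argo
    \<comment> \<open>In the lower comparison the deviations stand on the side of \<open>D\<close>,
      where the model offers nothing to absorb them. The least eigenvalue does, at the price of
      another factor ln T.\<close>
    have Y: "Y \<le> L / c * D"
    proof -
      have "c * sqrt (real t + 1) / L * (v \<bullet> v) \<le> D"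
        using min[OF T p, of t v] t by (simp add: L_def D_def)
      moreover have "c * sqrt (real t) / L * (v \<bullet> v) \<le> c * sqrt (real t + 1) / L * (v \<bullet> v)"
        using c L by (intro mult_right_mono divide_right_mono mult_left_mono) simp_all
      ultimately have "c * Y / L \<le> D" by (simp add: Y_def)
      then show ?thesis using c L by (simp add: field_simps)
    qed
    have "X + Y \<le> 2 * D + (2 * K + 1) * Y" using X by (simp add: algebra_simps)
    also have "\<dots> \<le> 2 * D + (2 * K + 1) * (L / c * D)"
      using Y K0 by (intro add_left_mono mult_left_mono) simp_all
    also have "\<dots> = (2 + 2 * C1 / c * (B\<^sup>2 * L\<^sup>2) + 1 / c * L) * D"
      by (simp add: K_def power2_eq_square algebra_simps add_divide_distrib)
    also have "\<dots> \<le> (C * B\<^sup>2 * L\<^sup>2) * D"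
    proof (rule mult_right_mono[OF _ D0])
      have "1 / c * L \<le> 1 / c * (B\<^sup>2 * L\<^sup>2)"
        using BL(3) c by (intro mult_left_mono) simp_all
      then have "2 + 2 * C1 / c * (B\<^sup>2 * L\<^sup>2) + 1 / c * L \<le> (2 + 2 * C1 / c + 1 / c) * (B\<^sup>2 * L\<^sup>2)"
        using BL(2) by (simp only: distrib_right)
      also have "\<dots> \<le> C * (B\<^sup>2 * L\<^sup>2)"
        using C1 BL(2) by (intro mult_right_mono) (simp_all add: C_def)
      finally show "2 + 2 * C1 / c * (B\<^sup>2 * L\<^sup>2) + 1 / c * L \<le> C * B\<^sup>2 * L\<^sup>2"
        by (simp only: mult.assoc)
    qed
    finally show ?thesis using up by (simp add: L_def D_def X_def Y_def)
  qed
  then show ?thesis using C by blast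
qed

section \<open>Exponential supermartingales\<close>

text \<open>\<open>real_cond_exp\<close> passes through \<open>enn2real\<close>, which sends
  infinity to 0. The bound therefore carries over only where the nonnegative conditional expectation
  is finite; integrability provides this almost everywhere.\<close>

lemma (in sigma_finite_subalgebra) nn_cond_exp_le_of_real_cond_exp_le:
  assumes f: "integrable M f" and nn: "\<And>x. 0 \<le> f x" and le: "AE x in M. real_cond_exp M F f x \<le> c"
  shows "AE x in M. nn_cond_exp M F (\<lambda>x. ennreal (f x)) x \<le> ennreal c"
proof -
  have [measurable]: "f \<in> borel_measurable M" using f by simp
  let ?g = "nn_cond_exp M F (\<lambda>x. ennreal (f x))"
  have "(\<integral>\<^sup>+x. ?g x \<partial>M) = (\<integral>\<^sup>+x. ennreal (f x) \<partial>M)"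
    using nn_cond_exp_intg[of "\<lambda>_. 1" "\<lambda>x. ennreal (f x)"] by simp
  also have "\<dots> < \<infinity>"
    using integrableD(2)[OF f] nn by (simp add: less_top)
  finally have fin: "AE x in M. ?g x \<noteq> \<infinity>"
    by (intro nn_integral_PInf_AE) (auto simp: less_top)
  have "AE x in M. 0 = nn_cond_exp M F (\<lambda>x. 0) x"
    by (rule nn_cond_exp_F_meas) auto
  moreover have "(\<lambda>x. ennreal (- f x)) = (\<lambda>x. 0)"
    by (simp add: ennreal_neg nn)
  ultimately have "AE x in M. real_cond_exp M F f x = enn2real (?g x)"
    unfolding real_cond_exp_def by auto
  with fin le show ?thesis
  proof eventually_elim
    case (elim x)
    then have "?g x = ennreal (enn2real (?g x))" by (simp add: less_top)
    also have "\<dots> \<le> ennreal c" using elim by (intro ennreal_leI) simp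
    finally show ?case .
  qed
qed

text \<open>The conditional moment generating function is only controlled at deterministic arguments;
  simple functions and Fatou's lemma extend the bound to predictable ones.\<close>

lemma (in sigma_finite_subalgebra) subgaussian_predictable:
  fixes X Y V :: "'a \<Rightarrow> real"
  assumes X[measurable]: "X \<in> borel_measurable M"
    and int: "\<And>l. integrable M (\<lambda>x. exp (l * X x))"
    and mgf: "\<And>l. AE x in M. real_cond_exp M F (\<lambda>x. exp (l * X x)) x \<le> exp (\<sigma>\<^sup>2 * l\<^sup>2 / 2)"
    and Y: "Y \<in> borel_measurable F" and V: "V \<in> borel_measurable F" and V0: "\<And>x. 0 \<le> V x"
  shows "(\<integral>\<^sup>+x. ennreal (V x * exp (Y x * X x - \<sigma>\<^sup>2 / 2 * (Y x)\<^sup>2)) \<partial>M) \<le> (\<integral>\<^sup>+x. ennreal (V x) \<partial>M)"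
proof -
  have FM: "g \<in> borel_measurable F \<Longrightarrow> g \<in> borel_measurable M" for g :: "'a \<Rightarrow> real"
    using measurable_from_subalg[OF subalg] .
  have sp: "space F = space M" using subalg by (simp add: subalgebra_def)
  have const: "(\<integral>\<^sup>+x. ennreal (W x * exp (l * X x - \<sigma>\<^sup>2 / 2 * l\<^sup>2)) \<partial>M) \<le> (\<integral>\<^sup>+x. ennreal (W x) \<partial>M)"
    if W: "W \<in> borel_measurable F" "\<And>x. 0 \<le> W x" for W l
  proof -
    note [measurable] = W(1) FM[OF W(1)]
    let ?g = "nn_cond_exp M F (\<lambda>x. ennreal (exp (l * X x)))"
    have le: "AE x in M. ?g x \<le> ennreal (exp (\<sigma>\<^sup>2 * l\<^sup>2 / 2))"
      by (rule nn_cond_exp_le_of_real_cond_exp_le[OF int _ mgf]) simp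
    have "(\<integral>\<^sup>+x. ennreal (W x * exp (l * X x - \<sigma>\<^sup>2 / 2 * l\<^sup>2)) \<partial>M)
        = (\<integral>\<^sup>+x. ennreal (W x * exp (- (\<sigma>\<^sup>2 * l\<^sup>2 / 2))) * ennreal (exp (l * X x)) \<partial>M)"
    proof -
      have "exp (l * X x - \<sigma>\<^sup>2 / 2 * l\<^sup>2) = exp (- (\<sigma>\<^sup>2 * l\<^sup>2 / 2)) * exp (l * X x)" for x
        by (simp add: mult_exp_exp)
      then show ?thesis
        using W(2) by (simp only: ennreal_mult mult.assoc exp_ge_zero mult_nonneg_nonneg)
    qed
    also have "\<dots> = (\<integral>\<^sup>+x. ennreal (W x * exp (- (\<sigma>\<^sup>2 * l\<^sup>2 / 2))) * ?g x \<partial>M)"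
      by (rule nn_cond_exp_intg[symmetric]) auto
    also have "\<dots> \<le> (\<integral>\<^sup>+x. ennreal (W x * exp (- (\<sigma>\<^sup>2 * l\<^sup>2 / 2))) * ennreal (exp (\<sigma>\<^sup>2 * l\<^sup>2 / 2)) \<partial>M)"
      by (intro nn_integral_mono_AE eventually_mono[OF le] mult_left_mono) simp_all
    also have "\<dots> = (\<integral>\<^sup>+x. ennreal (W x) \<partial>M)"
      using W(2) by (intro nn_integral_cong) (simp add: ennreal_mult'[symmetric] mult_exp_exp mult.assoc)
    finally show ?thesis .
  qed
  have simple: "(\<integral>\<^sup>+x. ennreal (V x * exp (Z x * X x - \<sigma>\<^sup>2 / 2 * (Z x)\<^sup>2)) \<partial>M) \<le> (\<integral>\<^sup>+x. ennreal (V x) \<partial>M)"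
    if Z: "simple_function F Z" for Z :: "'a \<Rightarrow> real"
  proof -
    define R where "R = Z ` space M"
    have R: "finite R" using simple_functionD(1)[OF Z] by (simp add: R_def sp)
    \<comment> \<open>On a level set of \<open>Z\<close> the argument is deterministic. The
      indicator of the level set is measurable in \<open>F\<close> and can join the weight, which is
      why \<open>const\<close> allows an arbitrary weight.\<close>
    define W where "W = (\<lambda>z x. V x * indicator (Z -` {z} \<inter> space M) x)"
    have sets: "Z -` {z} \<inter> space M \<in> sets F" for z
      using simple_functionD(2)[OF Z, of "{z}"] by (simp add: sp)
    have W: "W z \<in> borel_measurable F" "\<And>x. 0 \<le> W z x" for z
      using V sets[of z] V0 by (simp_all add: W_def)
    have dec: "V x * f (Z x) = (\<Sum>z\<in>R. W z x * f z)" if "x \<in> space M" for x and f :: "real \<Rightarrow> real"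
    proof -
      have "(\<Sum>z\<in>R. W z x * f z) = (\<Sum>z\<in>R. if z = Z x then V x * f z else 0)"
        using that by (intro sum.cong) (auto simp: W_def)
      also have "\<dots> = V x * f (Z x)"
        using R that by (simp add: R_def)
      finally show ?thesis by simp
    qed
    note [measurable] = FM[OF W(1)]
    have "(\<integral>\<^sup>+x. ennreal (V x * exp (Z x * X x - \<sigma>\<^sup>2 / 2 * (Z x)\<^sup>2)) \<partial>M)
        = (\<integral>\<^sup>+x. (\<Sum>z\<in>R. ennreal (W z x * exp (z * X x - \<sigma>\<^sup>2 / 2 * z\<^sup>2))) \<partial>M)"
    proof (intro nn_integral_cong)
      fix x assume "x \<in> space M"
      from dec[OF this, of "\<lambda>z. exp (z * X x - \<sigma>\<^sup>2 / 2 * z\<^sup>2)"]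
      show "ennreal (V x * exp (Z x * X x - \<sigma>\<^sup>2 / 2 * (Z x)\<^sup>2))
          = (\<Sum>z\<in>R. ennreal (W z x * exp (z * X x - \<sigma>\<^sup>2 / 2 * z\<^sup>2)))"
        using W(2) by (simp add: sum_ennreal)
    qed
    also have "\<dots> = (\<Sum>z\<in>R. \<integral>\<^sup>+x. ennreal (W z x * exp (z * X x - \<sigma>\<^sup>2 / 2 * z\<^sup>2)) \<partial>M)"
      by (rule nn_integral_sum) simp
    also have "\<dots> \<le> (\<Sum>z\<in>R. \<integral>\<^sup>+x. ennreal (W z x) \<partial>M)"
      by (intro sum_mono const W)
    also have "\<dots> = (\<integral>\<^sup>+x. (\<Sum>z\<in>R. ennreal (W z x)) \<partial>M)"
      by (rule nn_integral_sum[symmetric]) simp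
    also have "\<dots> = (\<integral>\<^sup>+x. ennreal (V x) \<partial>M)"
      using dec[of _ "\<lambda>_. 1"] W(2) by (intro nn_integral_cong) (simp add: sum_ennreal)
    finally show ?thesis .
  qed
  obtain Z where Z: "\<And>i. simple_function F (Z i)" "\<And>x. x \<in> space F \<Longrightarrow> (\<lambda>i. Z i x) \<longlonglongrightarrow> Y x"
    using borel_measurable_implies_sequence_metric[OF Y, of 0] by blast
  have [measurable]: "Z i \<in> borel_measurable M" for i
    by (rule FM[OF borel_measurable_simple_function[OF Z(1)]])
  note [measurable] = FM[OF V]
  let ?f = "\<lambda>z x. ennreal (V x * exp (z * X x - \<sigma>\<^sup>2 / 2 * z\<^sup>2))"
  have "(\<integral>\<^sup>+x. ?f (Y x) x \<partial>M) = (\<integral>\<^sup>+x. liminf (\<lambda>i. ?f (Z i x) x) \<partial>M)"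
  proof (intro nn_integral_cong)
    fix x assume "x \<in> space M"
    then have "(\<lambda>i. Z i x) \<longlonglongrightarrow> Y x" using Z(2) sp by simp
    then have "(\<lambda>i. ?f (Z i x) x) \<longlonglongrightarrow> ?f (Y x) x"
      by (intro tendsto_intros tendsto_ennrealI)
    then show "?f (Y x) x = liminf (\<lambda>i. ?f (Z i x) x)"
      by (simp add: lim_imp_Liminf)
  qed
  also have "\<dots> \<le> liminf (\<lambda>i. \<integral>\<^sup>+x. ?f (Z i x) x \<partial>M)"
    by (rule nn_integral_liminf) simp
  also have "\<dots> \<le> liminf (\<lambda>i :: nat. \<integral>\<^sup>+x. ennreal (V x) \<partial>M)"
    by (intro Liminf_mono always_eventually allI simple Z(1))
  also have "\<dots> = (\<integral>\<^sup>+x. ennreal (V x) \<partial>M)"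
    by (simp add: Liminf_const)
  finally show ?thesis .
qed

lemma nonneg_supermartingale_maximal:
  fixes X :: "nat \<Rightarrow> 'a \<Rightarrow> ennreal"
  assumes sub: "\<And>t. t \<le> n \<Longrightarrow> subalgebra M (F t)"
    and mono: "\<And>t. t < n \<Longrightarrow> sets (F t) \<subseteq> sets (F (Suc t))"
    and adapted: "\<And>t. t \<le> n \<Longrightarrow> X t \<in> borel_measurable (F t)"
    and super: "\<And>t A. t < n \<Longrightarrow> A \<in> sets (F t) \<Longrightarrow>
      (\<integral>\<^sup>+x\<in>A. X (Suc t) x \<partial>M) \<le> (\<integral>\<^sup>+x\<in>A. X t x \<partial>M)"
  shows "c * emeasure M {x \<in> space M. \<exists>t\<le>n. c \<le> X t x} \<le> (\<integral>\<^sup>+x. X 0 x \<partial>M)"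
proof -
  have sp: "space (F t) = space M" and FM: "A \<in> sets (F t) \<Longrightarrow> A \<in> sets M" if "t \<le> n" for t A
    using sub[OF that] by (auto simp: subalgebra_def)
  have meas: "X t \<in> borel_measurable M" if "t \<le> n" for t
    using measurable_from_subalg[OF sub[OF that] adapted[OF that]] .
  define B where "B t = {x \<in> space M. \<forall>s\<le>t. X s x < c}" for t
  have BF: "B t \<in> sets (F t)" if "t \<le> n" for t
    using that
  proof (induction t)
    case 0
    have "{x \<in> space (F 0). X 0 x < c} \<in> sets (F 0)"
      using adapted[of 0] by simp
    then show ?case by (simp add: B_def sp)
  next
    case (Suc t)
    have "B (Suc t) = B t \<inter> {x \<in> space (F (Suc t)). X (Suc t) x < c}"
      using Suc.prems by (auto simp: B_def sp le_Suc_eq)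
    moreover have "{x \<in> space (F (Suc t)). X (Suc t) x < c} \<in> sets (F (Suc t))"
      using adapted[OF Suc.prems] by simp
    moreover have "B t \<in> sets (F (Suc t))"
      using Suc mono[of t] by auto
    ultimately show ?case by simp
  qed
  have stop: "c * emeasure M (C - D) + (\<integral>\<^sup>+x\<in>D. X t x \<partial>M) \<le> (\<integral>\<^sup>+x\<in>C. X t x \<partial>M)"
    if t: "t \<le> n" and C[measurable]: "C \<in> sets M" and D: "D = {x \<in> C. X t x < c}" for t C D
  proof -
    note [measurable] = meas[OF t]
    have "D = C \<inter> {x \<in> space M. X t x < c}"
      using D sets.sets_into_space[OF C] by auto
    then have [measurable]: "D \<in> sets M" by simp
    have "c * emeasure M (C - D) + (\<integral>\<^sup>+x\<in>D. X t x \<partial>M)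
        = (\<integral>\<^sup>+x. c * indicator (C - D) x + X t x * indicator D x \<partial>M)"
      by (subst nn_integral_add) (simp_all add: nn_integral_cmult_indicator)
    also have "\<dots> \<le> (\<integral>\<^sup>+x\<in>C. X t x \<partial>M)"
      by (intro nn_integral_mono) (auto simp: D not_less split: split_indicator)
    finally show ?thesis .
  qed
  have "c * emeasure M (space M - B t) + (\<integral>\<^sup>+x\<in>B t. X t x \<partial>M) \<le> (\<integral>\<^sup>+x. X 0 x \<partial>M)"
    if "t \<le> n" for t
    using that
  proof (induction t)
    case 0
    have "(\<integral>\<^sup>+x\<in>space M. X 0 x \<partial>M) = (\<integral>\<^sup>+x. X 0 x \<partial>M)"
      by (intro nn_integral_cong) simp
    then show ?case using stop[of 0 "space M" "B 0"] by (simp add: B_def)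
  next
    case (Suc t)
    have [measurable]: "B t \<in> sets M" "B (Suc t) \<in> sets M"
      using BF FM Suc.prems by (meson Suc_leD)+
    have sub: "B (Suc t) \<subseteq> B t" "B t \<subseteq> space M" by (auto simp: B_def)
    then have "space M - B (Suc t) = (space M - B t) \<union> (B t - B (Suc t))" by auto
    then have "emeasure M (space M - B (Suc t))
        = emeasure M (space M - B t) + emeasure M (B t - B (Suc t))"
      by (simp only:) (rule plus_emeasure[symmetric], auto)
    then have "c * emeasure M (space M - B (Suc t)) + (\<integral>\<^sup>+x\<in>B (Suc t). X (Suc t) x \<partial>M)
        = c * emeasure M (space M - B t)
          + (c * emeasure M (B t - B (Suc t)) + (\<integral>\<^sup>+x\<in>B (Suc t). X (Suc t) x \<partial>M))"
      by (simp add: distrib_left add.assoc)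
    also have "\<dots> \<le> c * emeasure M (space M - B t) + (\<integral>\<^sup>+x\<in>B t. X (Suc t) x \<partial>M)"
    proof (rule add_left_mono, rule stop[OF Suc.prems])
      show "B t \<in> sets M" by fact
      show "B (Suc t) = {x \<in> B t. X (Suc t) x < c}" by (auto simp: B_def le_Suc_eq)
    qed
    also have "\<dots> \<le> c * emeasure M (space M - B t) + (\<integral>\<^sup>+x\<in>B t. X t x \<partial>M)"
      using Suc.prems BF[of t] by (intro add_left_mono super) simp_all
    also have "\<dots> \<le> (\<integral>\<^sup>+x. X 0 x \<partial>M)" using Suc by simp
    finally show ?case .
  qed
  from this[of n] have "c * emeasure M (space M - B n) \<le> (\<integral>\<^sup>+x. X 0 x \<partial>M)"
    by (meson add_increasing2 order_trans le_add_same_cancel1 zero_le order_refl)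
  moreover have "space M - B n = {x \<in> space M. \<exists>t\<le>n. c \<le> X t x}"
    by (auto simp: B_def not_less)
  ultimately show ?thesis by simp
qed

text \<open>Logarithm of the exponential supermartingale in direction \<open>l\<close>; the
  subtracted sum accumulates the sub-Gaussian bounds on the conditional cumulants of the
  increments.\<close>

definition exponent ::
    "real \<Rightarrow> (nat \<Rightarrow> real ^ 'd) \<Rightarrow> (nat \<Rightarrow> real) \<Rightarrow> real ^ 'd \<Rightarrow> nat \<Rightarrow> real" where
  "exponent \<sigma> a e l t = l \<bullet> (\<Sum>s\<in>{1..t}. e s *\<^sub>R a s) - \<sigma>\<^sup>2 / 2 * (\<Sum>s\<in>{1..t}. (a s \<bullet> l)\<^sup>2)"

lemma exponent_0: "exponent \<sigma> a e l 0 = 0"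
  by (simp add: exponent_def)

lemma exponent_Suc:
  "exponent \<sigma> a e l (Suc t)
    = exponent \<sigma> a e l t + ((a (Suc t) \<bullet> l) * e (Suc t) - \<sigma>\<^sup>2 / 2 * (a (Suc t) \<bullet> l)\<^sup>2)"
  by (simp add: exponent_def inner_add_right algebra_simps inner_commute)

section \<open>The filtration of a run and its exponential supermartingales\<close>

context linucb_ball
begin

abbreviation filtration :: "nat \<Rightarrow> 'w measure" where
  "filtration t \<equiv> history M a (reward \<theta> a \<epsilon>) t"

lemma space_filtration: "space (filtration t) = space M"
  by (simp add: history_def)

lemma pair_measurable_filtration:
  assumes "s \<in> {1..t}"
  shows "(\<lambda>\<omega>. (a s \<omega>, reward \<theta> a \<epsilon> s \<omega>)) \<in> borel_measurable (filtration t)"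
proof -
  let ?f = "\<lambda>\<omega>. \<lambda>s\<in>{1..t}. (a s \<omega>, reward \<theta> a \<epsilon> s \<omega>)"
  have "?f \<in> filtration t \<rightarrow>\<^sub>M (\<Pi>\<^sub>M s\<in>{1..t}. borel)"
    unfolding history_def by (rule measurable_vimage_algebra1) (auto simp: space_PiM)
  from measurable_compose[OF this measurable_component_singleton[OF assms]]
  show ?thesis using assms by simp
qed

lemma action_measurable_filtration:
  assumes "s \<in> {1..t}" shows "a s \<in> borel_measurable (filtration t)"
  using measurable_compose[OF pair_measurable_filtration[OF assms], of fst borel]
  by (simp add: borel_prod[symmetric])

lemma reward_measurable_filtration:
  assumes "s \<in> {1..t}" shows "reward \<theta> a \<epsilon> s \<in> borel_measurable (filtration t)"
  using measurable_compose[OF pair_measurable_filtration[OF assms], of snd borel]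
  by (simp add: borel_prod[symmetric])

lemma noise_measurable_filtration:
  assumes "s \<in> {1..t}" shows "\<epsilon> s \<in> borel_measurable (filtration t)"
proof -
  note [measurable] = action_measurable_filtration[OF assms] reward_measurable_filtration[OF assms]
  have "\<epsilon> s = (\<lambda>\<omega>. reward \<theta> a \<epsilon> s \<omega> - a s \<omega> \<bullet> \<theta>)" by (simp add: reward_def)
  then show ?thesis by simp
qed

lemma history_subalgebraI:
  assumes "space N = space M"
    and "\<And>s. s \<in> {1..t} \<Longrightarrow> a s \<in> borel_measurable N"
    and "\<And>s. s \<in> {1..t} \<Longrightarrow> reward \<theta> a \<epsilon> s \<in> borel_measurable N"
  shows "sets (filtration t) \<subseteq> sets N"
proof -
  have "(\<lambda>\<omega>. \<lambda>s\<in>{1..t}. (a s \<omega>, reward \<theta> a \<epsilon> s \<omega>)) \<in> N \<rightarrow>\<^sub>M (\<Pi>\<^sub>M s\<in>{1..t}. borel)"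
    using assms by (intro measurable_restrict borel_measurable_Pair)
  then show ?thesis
    unfolding history_def using assms(1) by (intro sets_image_in_sets) simp_all
qed

lemma filtration_mono: "s \<le> t \<Longrightarrow> sets (filtration s) \<subseteq> sets (filtration t)"
  by (rule history_subalgebraI)
    (auto simp: space_filtration intro: action_measurable_filtration reward_measurable_filtration)

text \<open>The locale gives measurability of an action only with respect to the preceding history.
  Strong induction lifts it to \<open>M\<close>: that history is already known to be a subalgebra,
  and rewards follow from actions and noise.\<close>

lemma subalgebra_filtration: "t \<le> T \<Longrightarrow> subalgebra M (filtration t)"
proof (induction t rule: less_induct)
  case (less t)
  have act: "a s \<in> borel_measurable M" if "s \<in> {1..t}" for s
    using less that by (intro measurable_from_subalg[OF less.IH action_predictable]) auto
  moreover have "reward \<theta> a \<epsilon> s \<in> borel_measurable M" if "s \<in> {1..t}" for s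
  proof -
    note [measurable] = act[OF that]
    have [measurable]: "\<epsilon> s \<in> borel_measurable M" using noise_measurable that less.prems by auto
    show ?thesis unfolding reward_def by simp
  qed
  ultimately show ?case
    unfolding subalgebra_def by (intro conjI space_filtration history_subalgebraI refl)
qed

lemma action_measurable: "s \<in> {1..T} \<Longrightarrow> a s \<in> borel_measurable M"
  using measurable_from_subalg[OF subalgebra_filtration[OF order_refl] action_measurable_filtration] .

lemma exponent_measurable_filtration:
  "(\<lambda>\<omega>. exponent \<sigma> (\<lambda>s. a s \<omega>) (\<lambda>s. \<epsilon> s \<omega>) l t) \<in> borel_measurable (filtration t)"
  unfolding exponent_def
  by (intro borel_measurable_diff borel_measurable_inner borel_measurable_sum borel_measurable_times
      borel_measurable_power borel_measurable_scaleR borel_measurable_const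
      action_measurable_filtration noise_measurable_filtration)

text \<open>A Chernoff bound that is uniform in time at no cost: the exponential process is a
  nonnegative supermartingale started at 1.\<close>

lemma exponent_maximal:
  assumes x: "x > 0"
  shows "prob {\<omega> \<in> space M. \<exists>t\<le>T. ln x \<le> exponent \<sigma> (\<lambda>s. a s \<omega>) (\<lambda>s. \<epsilon> s \<omega>) l t} \<le> 1 / x"
proof -
  let ?G = "\<lambda>t \<omega>. exponent \<sigma> (\<lambda>s. a s \<omega>) (\<lambda>s. \<epsilon> s \<omega>) l t"
  let ?X = "\<lambda>t \<omega>. ennreal (exp (?G t \<omega>))"
  let ?E = "{\<omega> \<in> space M. \<exists>t\<le>T. ln x \<le> ?G t \<omega>}"
  have "ennreal x * emeasure M {\<omega> \<in> space M. \<exists>t\<le>T. ennreal x \<le> ?X t \<omega>} \<le> (\<integral>\<^sup>+\<omega>. ?X 0 \<omega> \<partial>M)"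
  proof (rule nonneg_supermartingale_maximal)
    show "subalgebra M (filtration t)" if "t \<le> T" for t using that by (rule subalgebra_filtration)
    show "sets (filtration t) \<subseteq> sets (filtration (Suc t))" for t by (rule filtration_mono) simp
    show "?X t \<in> borel_measurable (filtration t)" for t
      using exponent_measurable_filtration[of l t] by simp
    fix t A assume t: "t < T" and A: "A \<in> sets (filtration t)"
    interpret F: finite_measure_subalgebra M "filtration t"
      using subalgebra_filtration t by unfold_locales simp
    have t': "Suc t \<in> {1..T}" "Suc t - 1 = t" using t by auto
    \<comment> \<open>The past of the process and the indicator of \<open>A\<close> together form
      the weight in \<open>subgaussian_predictable\<close>; only the increment of round
      \<open>Suc t\<close> is averaged.\<close>
    let ?V = "\<lambda>\<omega>. exp (?G t \<omega>) * indicator A \<omega>"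
    have V: "?V \<in> borel_measurable (filtration t)"
      using exponent_measurable_filtration[of l t] A by simp
    have Y: "(\<lambda>\<omega>. a (Suc t) \<omega> \<bullet> l) \<in> borel_measurable (filtration t)"
      using action_predictable[OF t'(1)] unfolding t'(2) by simp
    have "(\<integral>\<^sup>+\<omega>\<in>A. ?X (Suc t) \<omega> \<partial>M) = (\<integral>\<^sup>+\<omega>. ennreal (?V \<omega> *
        exp ((a (Suc t) \<omega> \<bullet> l) * \<epsilon> (Suc t) \<omega> - \<sigma>\<^sup>2 / 2 * (a (Suc t) \<omega> \<bullet> l)\<^sup>2)) \<partial>M)"
      by (intro nn_integral_cong)
        (auto simp: exponent_Suc exp_add split: split_indicator)
    also have "\<dots> \<le> (\<integral>\<^sup>+\<omega>. ennreal (?V \<omega>) \<partial>M)"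
      by (rule F.subgaussian_predictable[OF noise_measurable[OF t'(1)] noise_exp_integrable[OF t'(1)]
            noise_subgaussian[OF t'(1), unfolded t'(2)] Y V]) simp
    also have "\<dots> = (\<integral>\<^sup>+\<omega>\<in>A. ?X t \<omega> \<partial>M)"
      by (intro nn_integral_cong) (auto split: split_indicator)
    finally show "(\<integral>\<^sup>+\<omega>\<in>A. ?X (Suc t) \<omega> \<partial>M) \<le> (\<integral>\<^sup>+\<omega>\<in>A. ?X t \<omega> \<partial>M)" .
  qed
  moreover have "{\<omega> \<in> space M. \<exists>t\<le>T. ennreal x \<le> ?X t \<omega>} = ?E"
  proof -
    have "ln x \<le> y \<longleftrightarrow> x \<le> exp y" for y
      using x by (metis exp_le_cancel_iff exp_ln)
    then show ?thesis by simp
  qed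
  moreover have "(\<integral>\<^sup>+\<omega>. ?X 0 \<omega> \<partial>M) = 1"
    by (simp add: exponent_0 emeasure_space_1)
  ultimately have "ennreal (x * prob ?E) \<le> ennreal 1"
    using x by (simp add: emeasure_eq_measure ennreal_mult)
  then show ?thesis using x by (simp add: field_simps)
qed

lemma exponent_union_bound:
  assumes N: "finite N" "N \<noteq> {}" and \<delta>: "\<delta> > 0"
  shows "{\<omega> \<in> space M. \<exists>l\<in>N. \<exists>t\<le>T. ln (real (card N) / \<delta>)
      \<le> exponent \<sigma> (\<lambda>s. a s \<omega>) (\<lambda>s. \<epsilon> s \<omega>) l t} \<in> events" (is "?E \<in> _")
    and "prob {\<omega> \<in> space M. \<exists>l\<in>N. \<exists>t\<le>T. ln (real (card N) / \<delta>)
      \<le> exponent \<sigma> (\<lambda>s. a s \<omega>) (\<lambda>s. \<epsilon> s \<omega>) l t} \<le> \<delta>"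
proof -
  let ?x = "real (card N) / \<delta>"
  have card: "real (card N) > 0" using N by (metis card_gt_0_iff of_nat_0_less_iff)
  then have x: "?x > 0" using \<delta> by (rule divide_pos_pos)
  let ?A = "\<lambda>l. {\<omega> \<in> space M. \<exists>t\<le>T. ln ?x \<le> exponent \<sigma> (\<lambda>s. a s \<omega>) (\<lambda>s. \<epsilon> s \<omega>) l t}"
  have [measurable]: "(\<lambda>\<omega>. exponent \<sigma> (\<lambda>s. a s \<omega>) (\<lambda>s. \<epsilon> s \<omega>) l t) \<in> borel_measurable M"
    if "t \<le> T" for l t
    using measurable_from_subalg[OF subalgebra_filtration[OF that] exponent_measurable_filtration] .
  have A: "?A l \<in> events" for l
  proof -
    have "?A l = (\<Union>t\<in>{..T}. {\<omega> \<in> space M. ln ?x \<le> exponent \<sigma> (\<lambda>s. a s \<omega>) (\<lambda>s. \<epsilon> s \<omega>) l t})"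
      by auto
    also have "\<dots> \<in> events" by (intro sets.finite_UN) auto
    finally show ?thesis .
  qed
  have E: "?E = (\<Union>l\<in>N. ?A l)" by blast
  show "?E \<in> events" unfolding E using N(1) A by (intro sets.finite_UN)
  have "prob ?E \<le> (\<Sum>l\<in>N. prob (?A l))"
    unfolding E using N(1) A by (intro finite_measure_subadditive_finite) auto
  also have "\<dots> \<le> (\<Sum>l\<in>N. 1 / ?x)" by (intro sum_mono exponent_maximal x)
  also have "\<dots> = \<delta>" using card by simp
  finally show "prob ?E \<le> \<delta>" .
qed

end

section \<open>Nets for the score\<close>

definition grid :: "real \<Rightarrow> nat \<Rightarrow> (real ^ 'd) set" where
  "grid \<eta> K = (\<lambda>f. \<chi> i. \<eta> * of_int (f i)) ` (UNIV \<rightarrow>\<^sub>E {- int K..int K})"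

lemma grid_finite: "finite (grid \<eta> K)"
  unfolding grid_def by (intro finite_imageI finite_PiE) simp_all

lemma card_grid_le: "card (grid \<eta> K :: (real ^ 'd) set) \<le> (2 * K + 1) ^ CARD('d)"
proof -
  have "card (grid \<eta> K :: (real ^ 'd) set) \<le> card ((UNIV :: 'd set) \<rightarrow>\<^sub>E {- int K..int K})"
    unfolding grid_def by (intro card_image_le finite_PiE) simp_all
  also have "\<dots> = (2 * K + 1) ^ CARD('d)"
    by (subst card_PiE) (simp_all add: nat_add_distrib nat_mult_distrib)
  finally show ?thesis .
qed

text \<open>Each coordinate is rounded down to the lattice; estimating the error by the l1 norm
  yields the factor \<open>CARD('d)\<close>.\<close>

lemma grid_approx:
  fixes z :: "real ^ 'd" and \<eta> :: real
  assumes \<eta>: "\<eta> > 0" and z: "norm z \<le> \<eta> * real K"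
  shows "\<exists>g\<in>grid \<eta> K. norm (z - g) \<le> CARD('d) * \<eta>"
proof -
  define g :: "real ^ 'd" where "g = (\<chi> i. \<eta> * of_int \<lfloor>z $ i / \<eta>\<rfloor>)"
  have "\<bar>z $ i / \<eta>\<bar> \<le> real K" for i
  proof -
    have "\<bar>z $ i\<bar> \<le> \<eta> * real K" using component_le_norm_cart[of z i] z by linarith
    then show ?thesis using \<eta> by (simp add: abs_divide field_simps)
  qed
  then have "z $ i / \<eta> \<le> real K" "- real K \<le> z $ i / \<eta>" for i
    by (meson abs_le_D1, meson abs_le_D2 minus_le_iff)
  then have "\<lfloor>z $ i / \<eta>\<rfloor> \<in> {- int K..int K}" for i
    by (simp add: le_floor_iff floor_le_iff) (smt (verit))
  then have "g \<in> grid \<eta> K"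
    unfolding grid_def g_def by (intro image_eqI[where x = "\<lambda>i. \<lfloor>z $ i / \<eta>\<rfloor>"]) auto
  moreover have "\<bar>(z - g) $ i\<bar> \<le> \<eta>" for i
  proof -
    have "z $ i - \<eta> * of_int \<lfloor>z $ i / \<eta>\<rfloor> = \<eta> * (z $ i / \<eta> - of_int \<lfloor>z $ i / \<eta>\<rfloor>)"
      using \<eta> by (simp add: right_diff_distrib)
    moreover have "0 \<le> z $ i / \<eta> - of_int \<lfloor>z $ i / \<eta>\<rfloor>" "z $ i / \<eta> - of_int \<lfloor>z $ i / \<eta>\<rfloor> \<le> 1"
      by linarith+
    ultimately show ?thesis
      using \<eta> by (simp add: g_def abs_mult mult_left_le)
  qed
  then have "(\<Sum>i\<in>UNIV. \<bar>(z - g) $ i\<bar>) \<le> (\<Sum>i\<in>(UNIV :: 'd set). \<eta>)"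
    by (intro sum_mono)
  then have "norm (z - g) \<le> CARD('d) * \<eta>"
    using norm_le_l1_cart[of "z - g"] by simp
  ultimately show ?thesis by blast
qed

text \<open>The supremum over \<open>l\<close> of the exponent is essentially attained at \<open>l = y / \<sigma>\<^sup>2\<close>; the last term
  is the loss for using another \<open>l\<close>.\<close>

lemma score_le_exponent:
  fixes \<sigma> :: real and a :: "nat \<Rightarrow> real ^ 'd" and e :: "nat \<Rightarrow> real" and t :: nat and l :: "real ^ 'd"
  assumes \<sigma>: "\<sigma> > 0"
  defines "y \<equiv> matrix_inv (design a t) *v score a e t"
  defines "f \<equiv> l - (1 / \<sigma>\<^sup>2) *\<^sub>R y"
  shows "(mat_norm (matrix_inv (design a t)) (score a e t))\<^sup>2
    \<le> 2 * \<sigma>\<^sup>2 * exponent \<sigma> a e l t + \<sigma>\<^sup>2 * \<sigma>\<^sup>2 * (f \<bullet> (design a t *v f))"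
proof -
  let ?D = "design a t"
  note A = above_id_design[of a t]
  have Dy: "?D *v y = score a e t" by (simp add: y_def above_id_inv_mult(1)[OF A])
  have W: "(mat_norm (matrix_inv ?D) (score a e t))\<^sup>2 = y \<bullet> (?D *v y)"
    by (simp add: mat_norm_inv[OF A] mat_norm_sq[OF A] y_def)
  have c: "y \<bullet> (?D *v l) = l \<bullet> (?D *v y)"
    using above_id_sym[OF A, of l y] by (simp add: inner_commute)
  define r where "r = 1 / \<sigma>\<^sup>2"
  have r: "\<sigma>\<^sup>2 * r = 1" using \<sigma> by (simp add: r_def)
  have "f \<bullet> (?D *v f) = l \<bullet> (?D *v l) - 2 * r * (l \<bullet> (?D *v y)) + r * r * (y \<bullet> (?D *v y))"
    unfolding f_def r_def[symmetric]
    by (simp add: matrix_vector_mult_diff_distrib matrix_vector_mult_scaleR inner_diff_left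
        inner_diff_right c algebra_simps)
  then have "\<sigma>\<^sup>2 * \<sigma>\<^sup>2 * (f \<bullet> (?D *v f))
      = \<sigma>\<^sup>2 * \<sigma>\<^sup>2 * (l \<bullet> (?D *v l)) - 2 * \<sigma>\<^sup>2 * (\<sigma>\<^sup>2 * r) * (l \<bullet> (?D *v y))
        + (\<sigma>\<^sup>2 * r) * (\<sigma>\<^sup>2 * r) * (y \<bullet> (?D *v y))"
    by (simp only: right_diff_distrib distrib_left mult_ac)
  then have "\<sigma>\<^sup>2 * \<sigma>\<^sup>2 * (f \<bullet> (?D *v f))
      = \<sigma>\<^sup>2 * \<sigma>\<^sup>2 * (l \<bullet> (?D *v l)) - 2 * \<sigma>\<^sup>2 * (l \<bullet> (?D *v y)) + y \<bullet> (?D *v y)"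
    unfolding r by simp
  moreover have "2 * \<sigma>\<^sup>2 * exponent \<sigma> a e l t
      = 2 * \<sigma>\<^sup>2 * (l \<bullet> (?D *v y)) - \<sigma>\<^sup>2 * \<sigma>\<^sup>2 * (l \<bullet> (?D *v l)) + \<sigma>\<^sup>2 * \<sigma>\<^sup>2 * (l \<bullet> l)"
    unfolding exponent_def Dy design_quad by (simp add: algebra_simps)
  \<comment> \<open>The exponent sums over the actions only, whereas \<open>?D\<close> also contains
    the identity. The difference has the favourable sign and is dropped.\<close>
  moreover have "0 \<le> \<sigma>\<^sup>2 * \<sigma>\<^sup>2 * (l \<bullet> l)" by simp
  ultimately show ?thesis unfolding W by linarith
qed

text \<open>Here \<open>J\<close> is a frame adapted to the design matrix, and \<open>z\<close> gives the coordinates of the optimal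
  \<open>l\<close> in it.\<close>

definition score_net ::
    "real \<Rightarrow> (real ^ 'd \<Rightarrow> real ^ 'd) \<Rightarrow> real \<Rightarrow> real \<Rightarrow> (real ^ 'd) set \<Rightarrow> bool" where
  "score_net \<sigma> J R G N \<longleftrightarrow> (\<forall>a e t z X.
     (\<forall>v. J v \<bullet> (design a t *v J v) \<le> G * (v \<bullet> v)) \<longrightarrow> norm z \<le> R \<longrightarrow>
     J z = (1 / \<sigma>\<^sup>2) *\<^sub>R (matrix_inv (design a t) *v score a e t) \<longrightarrow>
     (\<forall>l\<in>N. exponent \<sigma> a e l t \<le> X) \<longrightarrow>
     (mat_norm (matrix_inv (design a t)) (score a e t))\<^sup>2 \<le> 2 * \<sigma>\<^sup>2 * X + 1)"

lemma score_netD: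
  assumes "score_net \<sigma> J R G N" "\<And>v. J v \<bullet> (design a t *v J v) \<le> G * (v \<bullet> v)" "norm z \<le> R"
    "J z = (1 / \<sigma>\<^sup>2) *\<^sub>R (matrix_inv (design a t) *v score a e t)"
    "\<And>l. l \<in> N \<Longrightarrow> exponent \<sigma> a e l t \<le> X"
  shows "(mat_norm (matrix_inv (design a t)) (score a e t))\<^sup>2 \<le> 2 * \<sigma>\<^sup>2 * X + 1"
  using assms(1)[unfolded score_net_def, rule_format, OF assms(2-4)] assms(5) by blast

lemma score_net_exists:
  fixes J :: "real ^ 'd \<Rightarrow> real ^ 'd" and \<sigma> R G :: real
  assumes \<sigma>: "\<sigma> > 0" and R: "R \<ge> 0" and G: "G > 0" and J: "linear J"
  obtains N where "finite N" "N \<noteq> {}"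
    "real (card N) \<le> (2 * R * \<sigma>\<^sup>2 * CARD('d) * sqrt G + 3) ^ CARD('d)" "score_net \<sigma> J R G N"
proof -
  define d where "d = real CARD('d)"
  have d: "d > 0" by (simp add: d_def)
  \<comment> \<open>Some grid point is within d \<open>\<eta>\<close> of the optimal coordinates, so
    this mesh makes the loss in \<open>score_le_exponent\<close> at most \<open>\<sigma>\<close>^4 G
    (d \<open>\<eta>\<close>)^2 = 1.\<close>
  define \<eta> where "\<eta> = 1 / (\<sigma>\<^sup>2 * d * sqrt G)"
  have \<eta>: "\<eta> > 0" using \<sigma> d G by (simp add: \<eta>_def)
  define K where "K = nat \<lceil>R / \<eta>\<rceil>"
  have Rn: "0 \<le> R / \<eta>" using R \<eta> by simp
  have K: "R / \<eta> \<le> real K" "real K \<le> R / \<eta> + 1"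
    unfolding K_def using Rn by linarith+
  define N where "N = J ` grid \<eta> K"
  have fin: "finite N" by (simp add: N_def grid_finite)
  have ne: "N \<noteq> {}"
    using grid_approx[OF \<eta>, of 0 K] \<eta> by (auto simp: N_def)
  have "card N \<le> card (grid \<eta> K :: (real ^ 'd) set)"
    unfolding N_def by (rule card_image_le[OF grid_finite])
  then have "card N \<le> (2 * K + 1) ^ CARD('d)"
    using card_grid_le[of \<eta> K, where 'd = 'd] by linarith
  then have "real (card N) \<le> real ((2 * K + 1) ^ CARD('d))" by (rule of_nat_mono)
  also have "\<dots> = (2 * real K + 1) ^ CARD('d)" by (simp add: add.commute)
  also have "\<dots> \<le> (2 * (R / \<eta>) + 3) ^ CARD('d)"
    using K by (intro power_mono) simp_all
  also have "2 * (R / \<eta>) + 3 = 2 * R * \<sigma>\<^sup>2 * d * sqrt G + 3"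
    by (simp add: \<eta>_def)
  finally have card: "real (card N) \<le> (2 * R * \<sigma>\<^sup>2 * d * sqrt G + 3) ^ CARD('d)" .
  have main: "(mat_norm (matrix_inv (design a t)) (score a e t))\<^sup>2 \<le> 2 * \<sigma>\<^sup>2 * X + 1"
    if up: "\<And>v. J v \<bullet> (design a t *v J v) \<le> G * (v \<bullet> v)" and z: "norm z \<le> R"
      and Jz: "J z = (1 / \<sigma>\<^sup>2) *\<^sub>R (matrix_inv (design a t) *v score a e t)"
      and X: "\<And>l. l \<in> N \<Longrightarrow> exponent \<sigma> a e l t \<le> X"
    for a e t z X
  proof -
    have "norm z \<le> \<eta> * real K" using z K(1) \<eta> by (simp add: field_simps)
    then obtain g where g: "g \<in> grid \<eta> K" "norm (z - g) \<le> d * \<eta>"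
      using grid_approx[OF \<eta>, of z K] by (auto simp: d_def)
    have f: "J g - (1 / \<sigma>\<^sup>2) *\<^sub>R (matrix_inv (design a t) *v score a e t) = J (g - z)"
      using J by (simp add: Jz linear_diff)
    have "(mat_norm (matrix_inv (design a t)) (score a e t))\<^sup>2
        \<le> 2 * \<sigma>\<^sup>2 * exponent \<sigma> a e (J g) t + \<sigma>\<^sup>2 * \<sigma>\<^sup>2 * (J (g - z) \<bullet> (design a t *v J (g - z)))"
      using score_le_exponent[OF \<sigma>, of a t e "J g"] unfolding f .
    also have "\<dots> \<le> 2 * \<sigma>\<^sup>2 * X + \<sigma>\<^sup>2 * \<sigma>\<^sup>2 * (G * (d * \<eta>)\<^sup>2)"
    proof (intro add_mono mult_left_mono)
      show "exponent \<sigma> a e (J g) t \<le> X" using X g(1) by (simp add: N_def)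
      have "J (g - z) \<bullet> (design a t *v J (g - z)) \<le> G * (norm (g - z))\<^sup>2"
        using up[of "g - z"] by (simp add: power2_norm_eq_inner)
      also have "\<dots> \<le> G * (d * \<eta>)\<^sup>2"
        using g(2) G by (intro mult_left_mono power_mono) (simp_all add: norm_minus_commute)
      finally show "J (g - z) \<bullet> (design a t *v J (g - z)) \<le> G * (d * \<eta>)\<^sup>2" .
    qed simp_all
    also have "\<sigma>\<^sup>2 * \<sigma>\<^sup>2 * (G * (d * \<eta>)\<^sup>2) = 1"
      using \<sigma> d G by (simp add: \<eta>_def power_mult_distrib power_divide)
    finally show ?thesis .
  qed
  have "score_net \<sigma> J R G N"
    unfolding score_net_def by (intro allI impI) (rule main, simp_all only: simp_thms Ball_def)
  then show ?thesis using fin ne card unfolding d_def by (intro that)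
qed

text \<open>The threshold allows a failure probability of \<open>1 / (3 ln T)\<close> for each of the three nets in use.\<close>

definition net_bounded ::
    "real \<Rightarrow> nat \<Rightarrow> (real ^ 'd) set \<Rightarrow> (nat \<Rightarrow> real ^ 'd) \<Rightarrow> (nat \<Rightarrow> real) \<Rightarrow> bool" where
  "net_bounded \<sigma> T N a e \<longleftrightarrow>
    (\<forall>l\<in>N. \<forall>t\<le>T. exponent \<sigma> a e l t < ln (real (card N) * (3 * ln (real T))))"

text \<open>The net consists of the signed coordinate vectors, independently of T. Compensator and
  threshold are both estimated by multiples of T; this is wasteful, but the result only has to
  supply a radius for the next net.\<close>

lemma polynomial_score_net:
  fixes \<sigma> :: real
  shows "\<exists>C>0. \<forall>T\<ge>3. \<exists>N :: (real ^ 'd) set. finite N \<and> N \<noteq> {} \<and>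
    (\<forall>a e t. (\<forall>s\<in>{1..T}. norm (a s) \<le> 1) \<longrightarrow> net_bounded \<sigma> T N a e \<longrightarrow> t \<le> T \<longrightarrow>
      norm (score a e t) \<le> C * real T)"
proof -
  define N where "N = range (\<lambda>i. axis i 1 :: real ^ 'd) \<union> range (\<lambda>i. - axis i 1)"
  have fin: "finite N" and ne: "N \<noteq> {}" by (auto simp: N_def)
  have card: "real (card N) > 0" using fin ne by (metis card_gt_0_iff of_nat_0_less_iff)
  define d where "d = real CARD('d)"
  have d: "d > 0" by (simp add: d_def)
  define C where "C = d * (3 * real (card N) + \<sigma>\<^sup>2 / 2)"
  have C: "C > 0" using card d by (simp add: C_def add_pos_nonneg)
  have main: "norm (score a e t) \<le> C * real T"
    if T: "T \<ge> 3" and a: "\<And>s. s \<in> {1..T} \<Longrightarrow> norm (a s) \<le> 1" and net: "net_bounded \<sigma> T N a e"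
      and t: "t \<le> T" for T a e t
  proof -
    define L where "L = ln (real T)"
    have L: "L \<ge> 1" "L \<le> real T"
      using ln_ge_1[OF T] ln_bound[of "real T"] T by (simp_all add: L_def)
    have "ln (real (card N) * (3 * L)) \<le> real (card N) * (3 * L)"
      using card L by (intro ln_bound) simp
    also have "\<dots> \<le> real (card N) * (3 * real T)" using L by (intro mult_left_mono) simp_all
    finally have lnN: "ln (real (card N) * (3 * L)) \<le> 3 * real (card N) * real T" by simp
    have ex: "l \<bullet> score a e t \<le> (3 * real (card N) + \<sigma>\<^sup>2 / 2) * real T" if l: "l \<in> N" for l
    proof -
      have "norm l = 1" using l by (auto simp: N_def)
      then have "(a s \<bullet> l)\<^sup>2 \<le> 1" if "s \<in> {1..t}" for s
        using Cauchy_Schwarz_ineq2[of "a s" l] a[of s] that t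
        by (intro abs_square_le_1[THEN iffD2]) auto
      then have "(\<Sum>s\<in>{1..t}. (a s \<bullet> l)\<^sup>2) \<le> (\<Sum>s\<in>{1..t}. 1)" by (rule sum_mono)
      also have "\<dots> \<le> real T" using t by simp
      finally have "\<sigma>\<^sup>2 / 2 * (\<Sum>s\<in>{1..t}. (a s \<bullet> l)\<^sup>2) \<le> \<sigma>\<^sup>2 / 2 * real T"
        by (intro mult_left_mono) simp_all
      moreover have "exponent \<sigma> a e l t < ln (real (card N) * (3 * L))"
        using net l t by (simp add: net_bounded_def L_def)
      ultimately show ?thesis
        using lnN unfolding exponent_def by (simp add: distrib_right)
    qed
    have "\<bar>score a e t $ i\<bar> \<le> (3 * real (card N) + \<sigma>\<^sup>2 / 2) * real T" for i
    proof -
      have "axis i 1 \<in> N" "- axis i 1 \<in> N" by (auto simp: N_def)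
      from ex[OF this(1)] ex[OF this(2)] show ?thesis
        by (simp only: inner_minus_left inner_axis' real_inner_1_left abs_le_iff)
    qed
    then have "(\<Sum>i\<in>UNIV. \<bar>score a e t $ i\<bar>)
        \<le> (\<Sum>i\<in>(UNIV :: 'd set). (3 * real (card N) + \<sigma>\<^sup>2 / 2) * real T)"
      by (intro sum_mono)
    then show ?thesis
      using norm_le_l1_cart[of "score a e t"] by (simp only: sum_constant C_def d_def mult.assoc)
  qed
  show ?thesis
    by (intro exI[of _ C] exI[of _ N] conjI allI impI C fin ne main) (simp_all only: Ball_def)
qed

lemma norm_inv_le:
  assumes A: "above_id A"
  shows "norm (matrix_inv A *v x) \<le> norm x"
proof -
  let ?y = "matrix_inv A *v x"
  have "(norm ?y)\<^sup>2 \<le> ?y \<bullet> x"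
    using above_id_ge[OF A, of ?y] unfolding above_id_inv_mult(1)[OF A] power2_norm_eq_inner .
  also have "\<dots> \<le> norm ?y * norm x" by (rule norm_cauchy_schwarz)
  finally have "norm ?y * norm ?y \<le> norm ?y * norm x" by (simp add: power2_eq_square)
  then show ?thesis by (cases "norm ?y = 0") (simp, metis mult_le_cancel_left_pos norm_ge_zero order_le_less)
qed

text \<open>The frame is the identity. The design is at most 1 + T times the identity, and its
  inverse does not increase norms, so the optimal \<open>l\<close> has norm at most C1 T /
  \<open>\<sigma>\<close>^2. The grid then has polynomially many points in T, and the logarithm of
  its size is of order ln T.\<close>

lemma logarithmic_score_net:
  fixes \<sigma> C1 :: real
  assumes \<sigma>: "\<sigma> > 0" and C1: "C1 > 0"
  shows "\<exists>C>0. \<forall>T\<ge>3. \<exists>N :: (real ^ 'd) set. finite N \<and> N \<noteq> {} \<and>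
    (\<forall>a e t. (\<forall>s\<in>{1..T}. norm (a s) \<le> 1) \<longrightarrow> net_bounded \<sigma> T N a e \<longrightarrow> t \<le> T \<longrightarrow>
      norm (score a e t) \<le> C1 * real T \<longrightarrow>
      (mat_norm (matrix_inv (design a t)) (score a e t))\<^sup>2 \<le> C * ln (real T))"
proof -
  define d where "d = CARD('d)"
  define \<alpha> where "\<alpha> = 2 * C1 * real d + 3"
  have \<alpha>: "\<alpha> \<ge> 1" using C1 by (simp add: \<alpha>_def)
  \<comment> \<open>The base of the cardinality bound is at most \<open>\<alpha>\<close> T^2, which
    gives the factor of d. The summand 3 pays for the threshold factor 3 ln T, estimated by 3 T,
    with ln 3 at most 2.\<close>
  define E where "E = real d * (ln \<alpha> + 2) + 3"
  have ln\<alpha>: "ln \<alpha> \<ge> 0" using \<alpha> by simp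
  have "0 \<le> real d * (ln \<alpha> + 2)" using ln\<alpha> by (intro mult_nonneg_nonneg) simp_all
  then have E: "E > 0" unfolding E_def by linarith
  define C where "C = 2 * \<sigma>\<^sup>2 * E + 1"
  have C: "C > 0" using E by (simp add: C_def add_nonneg_pos)
  have "\<exists>N :: (real ^ 'd) set. finite N \<and> N \<noteq> {} \<and>
    (\<forall>a e t. (\<forall>s\<in>{1..T}. norm (a s) \<le> 1) \<longrightarrow> net_bounded \<sigma> T N a e \<longrightarrow> t \<le> T \<longrightarrow>
      norm (score a e t) \<le> C1 * real T \<longrightarrow>
      (mat_norm (matrix_inv (design a t)) (score a e t))\<^sup>2 \<le> C * ln (real T))"
    if T: "T \<ge> 3" for T
  proof -
    define L where "L = ln (real T)"
    have L: "L \<ge> 1" "L \<le> real T"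
      using ln_ge_1[OF T] ln_bound[of "real T"] T by (simp_all add: L_def)
    have TT: "1 + real T \<le> (real T)\<^sup>2"
    proof -
      have "1 + real T \<le> 3 * real T" using T by simp
      also have "\<dots> \<le> (real T)\<^sup>2" using T by (simp add: power2_eq_square)
      finally show ?thesis .
    qed
    have R: "0 \<le> C1 * real T / \<sigma>\<^sup>2" and G: "0 < 1 + real T" using C1 by simp_all
    obtain N :: "(real ^ 'd) set" where N: "finite N" "N \<noteq> {}"
      and card: "real (card N) \<le> (2 * (C1 * real T / \<sigma>\<^sup>2) * \<sigma>\<^sup>2 * real d * sqrt (1 + real T) + 3) ^ d"
      and net: "score_net \<sigma> (\<lambda>z. z) (C1 * real T / \<sigma>\<^sup>2) (1 + real T) N"
      using score_net_exists[OF \<sigma> R G bounded_linear.linear[OF bounded_linear_ident[where 'a = "real ^ 'd"]]]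
      unfolding d_def by metis
    have cardpos: "real (card N) > 0" using N by (metis card_gt_0_iff of_nat_0_less_iff)
    have X: "ln (real (card N) * (3 * L)) \<le> E * L"
    proof -
      have "2 * (C1 * real T / \<sigma>\<^sup>2) * \<sigma>\<^sup>2 * real d * sqrt (1 + real T) + 3
          = 2 * C1 * real d * (real T * sqrt (1 + real T)) + 3"
        using \<sigma> by simp
      also have "\<dots> \<le> 2 * C1 * real d * (real T * real T) + 3 * (real T)\<^sup>2"
        using C1 T TT by (intro add_mono mult_left_mono real_le_lsqrt) simp_all
      also have "\<dots> = \<alpha> * (real T)\<^sup>2" by (simp add: \<alpha>_def power2_eq_square algebra_simps)
      finally have "real (card N) \<le> (\<alpha> * (real T)\<^sup>2) ^ d"
        using card C1 by (elim order_trans) (intro power_mono, simp_all)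
      then have "real (card N) * (3 * L) \<le> (\<alpha> * (real T)\<^sup>2) ^ d * (3 * real T)"
        using L \<alpha> by (intro mult_mono) simp_all
      then have "ln (real (card N) * (3 * L)) \<le> ln ((\<alpha> * (real T)\<^sup>2) ^ d * (3 * real T))"
        using cardpos L \<alpha> T by (subst ln_le_cancel_iff) simp_all
      also have "\<dots> = real d * (ln \<alpha> + 2 * L) + (ln 3 + L)"
        using \<alpha> T by (simp add: ln_mult ln_realpow L_def)
      also have "\<dots> \<le> real d * (ln \<alpha> * L + 2 * L) + (2 * L + L)"
        using L ln\<alpha> ln_le_minus_one[of 3] mult_left_mono[OF L(1) ln\<alpha>]
        by (intro add_mono mult_left_mono) simp_all
      also have "\<dots> = E * L" by (simp add: E_def algebra_simps)
      finally show ?thesis .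
    qed
    have main: "(mat_norm (matrix_inv (design a t)) (score a e t))\<^sup>2 \<le> C * L"
      if a: "\<And>s. s \<in> {1..T} \<Longrightarrow> norm (a s) \<le> 1" and nb: "net_bounded \<sigma> T N a e"
        and t: "t \<le> T" and S: "norm (score a e t) \<le> C1 * real T" for a e t
    proof -
      have "(mat_norm (matrix_inv (design a t)) (score a e t))\<^sup>2 \<le> 2 * \<sigma>\<^sup>2 * (E * L) + 1"
      proof (rule score_netD[OF net _ _ refl])
        show "v \<bullet> (design a t *v v) \<le> (1 + real T) * (v \<bullet> v)" for v
        proof -
          have "(\<Sum>s\<in>{1..t}. (a s \<bullet> v)\<^sup>2) \<le> (\<Sum>s\<in>{1..t}. v \<bullet> v)"
          proof (rule sum_mono)
            fix s assume "s \<in> {1..t}"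
            then have "a s \<bullet> a s \<le> 1"
              using a[of s] t by (simp add: dot_square_norm power_le_one)
            then have "(a s \<bullet> a s) * (v \<bullet> v) \<le> 1 * (v \<bullet> v)" by (intro mult_right_mono) simp_all
            then show "(a s \<bullet> v)\<^sup>2 \<le> v \<bullet> v"
              using Cauchy_Schwarz_ineq[of "a s" v] by linarith
          qed
          also have "\<dots> \<le> real T * (v \<bullet> v)" using t by (simp add: mult_right_mono)
          finally show "v \<bullet> (design a t *v v) \<le> (1 + real T) * (v \<bullet> v)"
            unfolding design_quad by (simp add: distrib_right)
        qed
        have "norm (matrix_inv (design a t) *v score a e t) \<le> C1 * real T"
          using norm_inv_le[OF above_id_design] S by (rule order_trans)
        then show "norm ((1 / \<sigma>\<^sup>2) *\<^sub>R (matrix_inv (design a t) *v score a e t)) \<le> C1 * real T / \<sigma>\<^sup>2"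
          using \<sigma> by (simp add: divide_right_mono)
        show "exponent \<sigma> a e l t \<le> E * L" if "l \<in> N" for l
          using nb that t X unfolding net_bounded_def L_def by (meson less_imp_le order_trans)
      qed
      also have "\<dots> \<le> C * L" using L by (simp add: C_def algebra_simps)
      finally show ?thesis .
    qed
    show ?thesis
      unfolding L_def[symmetric] by (intro exI[of _ N] conjI allI impI N main) (simp_all only: Ball_def)
  qed
  then show ?thesis using C by (intro exI[of _ C] conjI allI impI)
qed

text \<open>Turns the norm of \<open>p\<^sup>4 \<theta>\<theta>\<^sup>T + p\<^sup>2 I\<close> into the Euclidean norm, up to a factor 2.\<close>

definition rescale :: "real \<Rightarrow> real ^ 'd \<Rightarrow> real ^ 'd \<Rightarrow> real ^ 'd" where
  "rescale p \<theta> v = (1 / p) *\<^sub>R v + ((1 / p\<^sup>2 - 1 / p) * (\<theta> \<bullet> v)) *\<^sub>R \<theta>"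

lemma linear_rescale: "linear (rescale p \<theta>)"
  by (rule linearI) (simp_all add: rescale_def inner_add_right algebra_simps add_divide_distrib)

lemma inner_rescale:
  assumes "norm \<theta> = 1"
  shows "\<theta> \<bullet> rescale p \<theta> v = (\<theta> \<bullet> v) / p\<^sup>2"
proof -
  have "\<theta> \<bullet> \<theta> = 1" using assms by (simp add: dot_square_norm)
  then show ?thesis by (simp add: rescale_def inner_add_right algebra_simps)
qed

lemma rescale_inner_rescale:
  assumes "norm \<theta> = 1"
  shows "rescale p \<theta> v \<bullet> rescale p \<theta> v = (v \<bullet> v) / p\<^sup>2 + (1 / p ^ 4 - 1 / p\<^sup>2) * (\<theta> \<bullet> v)\<^sup>2"
proof -
  have t: "\<theta> \<bullet> \<theta> = 1" using assms by (simp add: dot_square_norm)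
  define q where "q = 1 / p"
  have q: "1 / p\<^sup>2 = q\<^sup>2" "1 / p ^ 4 = q ^ 4" "(v \<bullet> v) / p\<^sup>2 = q\<^sup>2 * (v \<bullet> v)"
    by (simp_all add: q_def power_divide)
  show ?thesis
    unfolding rescale_def q q_def[symmetric]
    by (simp add: inner_add_right inner_add_left inner_commute t algebra_simps power2_eq_square
        power4_eq_xxxx)
qed

lemma rescale_inverse:
  assumes "norm \<theta> = 1" "p \<noteq> 0"
  shows "rescale p \<theta> (rescale (1 / p) \<theta> y) = y"
proof -
  have "rescale p \<theta> (rescale (1 / p) \<theta> y) = (1 / p) *\<^sub>R rescale (1 / p) \<theta> y
      + ((1 / p\<^sup>2 - 1 / p) * (p\<^sup>2 * (\<theta> \<bullet> y))) *\<^sub>R \<theta>"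
    unfolding rescale_def[of p] inner_rescale[OF assms(1)] by (simp add: power_divide mult.commute)
  also have "(1 / p) *\<^sub>R rescale (1 / p) \<theta> y = y + ((p - 1) * (\<theta> \<bullet> y)) *\<^sub>R \<theta>"
    using assms(2) by (simp add: rescale_def scaleR_add_right power2_eq_square field_simps)
  also have "(1 / p\<^sup>2 - 1 / p) * (p\<^sup>2 * (\<theta> \<bullet> y)) = - ((p - 1) * (\<theta> \<bullet> y))"
    using assms(2) by (simp add: power2_eq_square field_simps)
  finally show ?thesis by simp
qed

text \<open>In the block of \<open>k\<close>, with q = 2^k, the frame
  \<open>rescale q \<theta>\<close> turns the two comparisons with the model matrix into a bound
  \<open>G\<close> on the design and a radius \<open>R\<close> for the coordinates of the optimal
  \<open>l\<close>, both powers of ln T. So each block has a grid of polylogarithmic size. There are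
  at most ln T + 1 blocks, and the logarithm of the union is of order 1 + ln ln T.\<close>

lemma doubly_logarithmic_score_net:
  fixes \<sigma> \<beta> C2 :: real
  assumes \<sigma>: "\<sigma> > 0" and \<beta>: "\<beta> > 0" and C2: "C2 > 0"
  shows "\<exists>C>0. \<forall>T\<ge>3. \<forall>\<theta> :: real ^ 'd. norm \<theta> = 1 \<longrightarrow> (\<exists>N. finite N \<and> N \<noteq> {} \<and>
    (\<forall>a e t. ucb_path \<beta> \<theta> T a e \<longrightarrow> net_bounded \<sigma> T N a e \<longrightarrow>
      (\<forall>t\<le>T. (mat_norm (matrix_inv (design a t)) (score a e t))\<^sup>2 \<le> C2 * ln (real T)) \<longrightarrow>
      t \<in> {1..T} \<longrightarrow>
      (mat_norm (matrix_inv (design a t)) (score a e t))\<^sup>2 \<le> C * (1 + ln (ln (real T)))))"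
proof -
  obtain C0 where C0: "C0 > 0" and comp: "\<forall>T\<ge>3. \<forall>(\<theta> :: real ^ 'd) a e B. ucb_path \<beta> \<theta> T a e \<longrightarrow> B \<ge> 1 \<longrightarrow>
    (\<forall>t\<le>T. mat_norm (design a t) (ridge a (\<lambda>s. a s \<bullet> \<theta> + e s) t - \<theta>) \<le> B) \<longrightarrow>
    (\<forall>t\<in>{1..T}. \<forall>v.
      v \<bullet> (design a t *v v)
        \<le> C0 * B\<^sup>2 * ln (real T) * (real t * (\<theta> \<bullet> v)\<^sup>2 + sqrt (real t) * (v \<bullet> v)) \<and>
      real t * (\<theta> \<bullet> v)\<^sup>2 + sqrt (real t) * (v \<bullet> v)
        \<le> C0 * B\<^sup>2 * (ln (real T))\<^sup>2 * (v \<bullet> (design a t *v v)))"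
    using ucb_path_design_comparable[OF \<beta>, where 'd = 'd] by (elim exE conjE)
  define d where "d = CARD('d)"
  define F where "F = (1 + sqrt C2)\<^sup>2"
  have F: "F \<ge> 1" "C2 \<le> F"
    using C2 by (simp_all add: F_def power2_eq_square algebra_simps)
  \<comment> \<open>The base of the cardinality bound is at most \<open>\<alpha> * L ^ 3\<close>:
    the radius contributes L^2 and sqrt G contributes L. In \<open>E\<close> below, ln 6 + 2 stands
    for the factor 6 L^2, namely 2 L for the number of blocks and 3 L from the threshold.\<close>
  define \<alpha> where "\<alpha> = 2 * (sqrt C0 * F) * real d * sqrt (20 * C0 * F) + 3"
  have \<alpha>: "\<alpha> \<ge> 3" using C0 F by (simp add: \<alpha>_def)
  have ln\<alpha>: "ln \<alpha> \<ge> 0" using \<alpha> by simp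
  define E where "E = ln 6 + 2 + real d * (ln \<alpha> + 3)"
  have "0 \<le> real d * (ln \<alpha> + 3)" using ln\<alpha> by (intro mult_nonneg_nonneg) simp_all
  then have E: "E > 0" unfolding E_def by (simp add: add_pos_nonneg)
  define C where "C = 2 * \<sigma>\<^sup>2 * E + 1"
  have C: "C > 0" using E by (simp add: C_def add_nonneg_pos)
  have "\<exists>N. finite N \<and> N \<noteq> {} \<and>
    (\<forall>a e t. ucb_path \<beta> \<theta> T a e \<longrightarrow> net_bounded \<sigma> T N a e \<longrightarrow>
      (\<forall>t\<le>T. (mat_norm (matrix_inv (design a t)) (score a e t))\<^sup>2 \<le> C2 * ln (real T)) \<longrightarrow>
      t \<in> {1..T} \<longrightarrow>
      (mat_norm (matrix_inv (design a t)) (score a e t))\<^sup>2 \<le> C * (1 + ln (ln (real T))))"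
    if T: "T \<ge> 3" and th: "norm \<theta> = 1" for T and \<theta> :: "real ^ 'd"
  proof -
    define L where "L = ln (real T)"
    have L: "L \<ge> 1" using ln_ge_1[OF T] by (simp add: L_def)
    \<comment> \<open>Chosen so that W + 1, with W^2 at most C2 L, is at most \<open>B\<close>; this
      bounds the ridge error.\<close>
    define B where "B = (1 + sqrt C2) * sqrt L"
    have "1 * 1 \<le> (1 + sqrt C2) * sqrt L" using L C2 by (intro mult_mono) simp_all
    then have B: "B \<ge> 1" "B\<^sup>2 = F * L"
      using L by (simp_all add: B_def F_def power_mult_distrib)
    \<comment> \<open>Both use B^2 = F L. The square of \<open>R\<close> is C0 B^2 L^2 W^2 /
      \<open>\<sigma>\<close>^4 from the lower comparison, with W^2 at most F L. \<open>G\<close> is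
      C0 B^2 L from the upper comparison, times 20 = 16 + 4, since t is at most 16 q^4 and sqrt t at
      most 4 q^2.\<close>
    define R where "R = sqrt C0 * F * L\<^sup>2 / \<sigma>\<^sup>2"
    define G where "G = 20 * C0 * F * L\<^sup>2"
    have R: "R \<ge> 0" and G: "G > 0" using C0 F L by (simp_all add: R_def G_def)
    have "\<exists>N. finite N \<and> N \<noteq> {} \<and> real (card N) \<le> (\<alpha> * L ^ 3) ^ d \<and>
        score_net \<sigma> (rescale (2 ^ k) \<theta>) R G N" for k :: nat
    proof -
      obtain N where N: "finite N" "N \<noteq> {}" "score_net \<sigma> (rescale (2 ^ k) \<theta>) R G N"
        and card: "real (card N) \<le> (2 * R * \<sigma>\<^sup>2 * CARD('d) * sqrt G + 3) ^ CARD('d)"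
        using score_net_exists[OF \<sigma> R G linear_rescale[of "2 ^ k" \<theta>]] by metis
      have "2 * R * \<sigma>\<^sup>2 * real d * sqrt G + 3 = 2 * (sqrt C0 * F) * real d * sqrt (20 * C0 * F) * L ^ 3 + 3"
        using \<sigma> L by (simp add: R_def G_def real_sqrt_mult power2_eq_square power3_eq_cube)
      also have "\<dots> \<le> \<alpha> * L ^ 3"
        using L one_le_power[of L 3] by (simp add: \<alpha>_def distrib_right)
      finally have "(2 * R * \<sigma>\<^sup>2 * real d * sqrt G + 3) ^ d \<le> (\<alpha> * L ^ 3) ^ d"
        using R G by (intro power_mono) simp_all
      with card have "real (card N) \<le> (\<alpha> * L ^ 3) ^ d" unfolding d_def by (rule order_trans)
      then show ?thesis using N by blast
    qed
    then obtain Nk where Nk: "\<And>k. finite (Nk k)" "\<And>k. Nk k \<noteq> {}"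
        "\<And>k. real (card (Nk k)) \<le> (\<alpha> * L ^ 3) ^ d" "\<And>k. score_net \<sigma> (rescale (2 ^ k) \<theta>) R G (Nk k)"
      by metis
    define n where "n = nat \<lfloor>L\<rfloor>"
    have n: "real n \<le> L" using L unfolding n_def by linarith
    \<comment> \<open>\<open>Nk k\<close> serves the rounds \<open>16 ^ k \<le> t < 16 ^ (k + 1)\<close>, on which \<open>t\<close> is about \<open>(2 ^ k) ^ 4\<close>.\<close>
    define N where "N = (\<Union>k\<in>{..n}. Nk k)"
    have N: "finite N" "N \<noteq> {}" using Nk(1,2) by (auto simp: N_def)
    have cardpos: "real (card N) > 0" using N by (metis card_gt_0_iff of_nat_0_less_iff)
    have \<alpha>L: "(\<alpha> * L ^ 3) ^ d > 0" using \<alpha> L by simp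
    define X where "X = ln (real (card N) * (3 * L))"
    have X: "X \<le> E * (1 + ln L)"
    proof -
      have "card N \<le> (\<Sum>k\<in>{..n}. card (Nk k))" unfolding N_def by (rule card_UN_le) simp
      then have "real (card N) \<le> (\<Sum>k\<in>{..n}. real (card (Nk k)))"
        by (metis of_nat_mono of_nat_sum)
      also have "\<dots> \<le> (\<Sum>k\<in>{..n}. (\<alpha> * L ^ 3) ^ d)" by (intro sum_mono Nk(3))
      also have "\<dots> = (1 + real n) * (\<alpha> * L ^ 3) ^ d" by simp
      also have "\<dots> \<le> (2 * L) * (\<alpha> * L ^ 3) ^ d"
        using n L \<alpha>L by (intro mult_right_mono) simp_all
      finally have "real (card N) * (3 * L) \<le> (2 * L) * (\<alpha> * L ^ 3) ^ d * (3 * L)"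
        using L by (intro mult_right_mono) simp_all
      also have "\<dots> = 6 * L\<^sup>2 * (\<alpha> * L ^ 3) ^ d" by (simp add: power2_eq_square)
      finally have "X \<le> ln (6 * L\<^sup>2 * (\<alpha> * L ^ 3) ^ d)"
        unfolding X_def using cardpos L \<alpha>L by (subst ln_le_cancel_iff) simp_all
      also have "\<dots> = ln 6 + 2 * ln L + real d * (ln \<alpha> + 3 * ln L)"
        using \<alpha> L by (simp add: ln_mult ln_realpow)
      also have "\<dots> \<le> ln 6 * (1 + ln L) + 2 * (1 + ln L) + real d * ((ln \<alpha> + 3) * (1 + ln L))"
      proof (intro add_mono mult_left_mono)
        have l: "ln L \<ge> 0" using L by simp
        show "ln 6 \<le> ln 6 * (1 + ln L)" using l by (simp add: algebra_simps)
        show "ln \<alpha> + 3 * ln L \<le> (ln \<alpha> + 3) * (1 + ln L)"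
          using mult_nonneg_nonneg[OF ln\<alpha> l] by (simp add: algebra_simps)
      qed simp_all
      also have "\<dots> = E * (1 + ln L)" by (simp add: E_def algebra_simps)
      finally show ?thesis .
    qed
    have main: "(mat_norm (matrix_inv (design a t)) (score a e t))\<^sup>2 \<le> C * (1 + ln L)"
      if p: "ucb_path \<beta> \<theta> T a e" and nb: "net_bounded \<sigma> T N a e"
        and W: "\<forall>t\<le>T. (mat_norm (matrix_inv (design a t)) (score a e t))\<^sup>2 \<le> C2 * L"
        and t: "t \<in> {1..T}" for a e t
    proof -
      have err: "mat_norm (design a s) (ridge a (\<lambda>s. a s \<bullet> \<theta> + e s) s - \<theta>) \<le> B" if "s \<le> T" for s
      proof -
        have "mat_norm (matrix_inv (design a s)) (score a e s) \<le> sqrt (C2 * L)"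
          using W that mat_norm_inv_nonneg[OF above_id_design] by (intro real_le_rsqrt) blast
        moreover have "1 \<le> sqrt L" using L by simp
        ultimately have "mat_norm (matrix_inv (design a s)) (score a e s) + 1 \<le> B"
          unfolding B_def real_sqrt_mult distrib_right by linarith
        with ridge_error_le[OF th, of a s e] show ?thesis by linarith
      qed
      have up: "v \<bullet> (design a t *v v) \<le> C0 * B\<^sup>2 * L * (real t * (\<theta> \<bullet> v)\<^sup>2 + sqrt (real t) * (v \<bullet> v))"
        and low: "real t * (\<theta> \<bullet> v)\<^sup>2 + sqrt (real t) * (v \<bullet> v) \<le> C0 * B\<^sup>2 * L\<^sup>2 * (v \<bullet> (design a t *v v))"
        for v
        using comp[rule_format, OF T p B(1) err t, of v] unfolding L_def by simp_all
      obtain k where k: "16 ^ k \<le> t" "t < 16 ^ (k + 1)"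
        using ex_power_ivl1[of 16 t] t by auto
      define q :: real where "q = 2 ^ k"
      have q1: "q \<ge> 1" by (simp add: q_def)
      have q4: "q ^ 4 = 16 ^ k"
      proof -
        have "q ^ 4 = 2 ^ (4 * k)" unfolding q_def by (simp only: power_mult[symmetric] mult.commute)
        also have "\<dots> = (2 ^ 4) ^ k" by (rule power_mult)
        finally show ?thesis by simp
      qed
      have tq: "q ^ 4 \<le> real t" "real t \<le> 16 * q ^ 4"
      proof -
        have "real (16 ^ k) \<le> real t" "real t \<le> real (16 ^ (k + 1))"
          using k by (simp_all only: of_nat_le_iff less_imp_le)
        then show "q ^ 4 \<le> real t" "real t \<le> 16 * q ^ 4" by (simp_all add: q4)
      qed
      have st: "q\<^sup>2 \<le> sqrt (real t)" "sqrt (real t) \<le> 4 * q\<^sup>2"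
      proof -
        have "q ^ 4 = (q\<^sup>2)\<^sup>2" by simp
        then show "q\<^sup>2 \<le> sqrt (real t)" "sqrt (real t) \<le> 4 * q\<^sup>2"
          using tq by (simp_all add: real_le_rsqrt real_le_lsqrt power_mult_distrib)
      qed
      have "k \<le> n"
      proof -
        have "real k \<le> real k * ln 16"
          using ln_ge_1[of 16] by (simp add: mult_le_cancel_left1)
        also have "\<dots> = ln (16 ^ k)" by (simp add: ln_realpow)
        also have "\<dots> \<le> L" unfolding L_def
          using tq(1) t T by (subst ln_le_cancel_iff) (simp_all add: q4[symmetric] q_def)
        finally show ?thesis unfolding n_def by (simp add: le_nat_floor)
      qed
      let ?y = "matrix_inv (design a t) *v score a e t"
      let ?J = "rescale q \<theta>"
      have thv: "(\<theta> \<bullet> v)\<^sup>2 \<le> v \<bullet> v" for v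
      proof -
        have "\<theta> \<bullet> \<theta> = 1" using th by (simp add: dot_square_norm)
        then show ?thesis using Cauchy_Schwarz_ineq[of \<theta> v] by simp
      qed
      have "(mat_norm (matrix_inv (design a t)) (score a e t))\<^sup>2 \<le> 2 * \<sigma>\<^sup>2 * X + 1"
      proof (rule score_netD[OF Nk(4)[of k, folded q_def]])
        show "?J v \<bullet> (design a t *v ?J v) \<le> G * (v \<bullet> v)" for v
        proof -
          have "real t * (\<theta> \<bullet> ?J v)\<^sup>2 = real t / q ^ 4 * (\<theta> \<bullet> v)\<^sup>2"
            by (simp add: inner_rescale[OF th] power_divide)
          also have "\<dots> \<le> 16 * (v \<bullet> v)"
            using tq q1 by (intro mult_mono thv) (simp_all add: divide_le_eq)
          finally have 1: "real t * (\<theta> \<bullet> ?J v)\<^sup>2 \<le> 16 * (v \<bullet> v)" .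
          have "1 / q ^ 4 \<le> 1 / q\<^sup>2" using q1 by (intro divide_left_mono power_increasing) simp_all
          then have "(1 / q ^ 4 - 1 / q\<^sup>2) * (\<theta> \<bullet> v)\<^sup>2 \<le> 0" by (intro mult_nonpos_nonneg) simp_all
          then have "?J v \<bullet> ?J v \<le> (v \<bullet> v) / q\<^sup>2"
            unfolding rescale_inner_rescale[OF th] by linarith
          then have "sqrt (real t) * (?J v \<bullet> ?J v) \<le> (4 * q\<^sup>2) * ((v \<bullet> v) / q\<^sup>2)"
            using st q1 by (intro mult_mono) simp_all
          then have 2: "sqrt (real t) * (?J v \<bullet> ?J v) \<le> 4 * (v \<bullet> v)" using q1 by simp
          have "?J v \<bullet> (design a t *v ?J v) \<le> C0 * B\<^sup>2 * L * (20 * (v \<bullet> v))"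
            using up[of "?J v"] 1 2 C0 L
            by (elim order_trans) (intro mult_left_mono, simp_all)
          then show ?thesis unfolding B(2) G_def by (simp add: power2_eq_square mult_ac)
        qed
        let ?z = "rescale (1 / q) \<theta> ((1 / \<sigma>\<^sup>2) *\<^sub>R ?y)"
        show "?J ?z = (1 / \<sigma>\<^sup>2) *\<^sub>R ?y" using q1 by (intro rescale_inverse th) simp
        show "norm ?z \<le> R"
        proof (rule power2_le_imp_le[OF _ R])
          have "?z = (1 / \<sigma>\<^sup>2) *\<^sub>R rescale (1 / q) \<theta> ?y"
            by (rule linear_cmul[OF linear_rescale])
          then have "(norm ?z)\<^sup>2 = (1 / \<sigma>\<^sup>2)\<^sup>2 * (rescale (1 / q) \<theta> ?y \<bullet> rescale (1 / q) \<theta> ?y)"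
            by (simp only: norm_scaleR power_mult_distrib power2_abs power2_norm_eq_inner)
          also have "\<dots> \<le> (1 / \<sigma>\<^sup>2)\<^sup>2 * (C0 * F\<^sup>2 * L ^ 4)"
          proof (rule mult_left_mono)
            have "rescale (1 / q) \<theta> ?y \<bullet> rescale (1 / q) \<theta> ?y
                = q\<^sup>2 * (?y \<bullet> ?y) + (q ^ 4 - q\<^sup>2) * (\<theta> \<bullet> ?y)\<^sup>2"
              unfolding rescale_inner_rescale[OF th] by (simp add: power_divide)
            also have "\<dots> \<le> sqrt (real t) * (?y \<bullet> ?y) + real t * (\<theta> \<bullet> ?y)\<^sup>2"
              using st(1) tq(1) zero_le_power2[of q] by (intro add_mono mult_right_mono) (linarith | simp)+
            also have "\<dots> \<le> C0 * B\<^sup>2 * L\<^sup>2 * (?y \<bullet> (design a t *v ?y))"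
              using low[of ?y] by simp
            also have "?y \<bullet> (design a t *v ?y) = (mat_norm (matrix_inv (design a t)) (score a e t))\<^sup>2"
              by (simp only: mat_norm_inv[OF above_id_design] mat_norm_sq[OF above_id_design])
            also have "C0 * B\<^sup>2 * L\<^sup>2 * \<dots> \<le> C0 * B\<^sup>2 * L\<^sup>2 * (F * L)"
            proof (rule mult_left_mono)
              have "C2 * L \<le> F * L" using F L by (intro mult_right_mono) simp_all
              then show "(mat_norm (matrix_inv (design a t)) (score a e t))\<^sup>2 \<le> F * L"
                using W t by (meson atLeastAtMost_iff order_trans)
            qed (use C0 in simp)
            also have "\<dots> = C0 * F\<^sup>2 * L ^ 4"
              unfolding B(2) by (simp add: power2_eq_square power4_eq_xxxx)
            finally show "rescale (1 / q) \<theta> ?y \<bullet> rescale (1 / q) \<theta> ?y \<le> C0 * F\<^sup>2 * L ^ 4" .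
          qed simp
          also have "\<dots> = R\<^sup>2"
            using C0 by (simp add: R_def power_divide power_mult_distrib power_mult[symmetric])
          finally show "(norm ?z)\<^sup>2 \<le> R\<^sup>2" .
        qed
        show "exponent \<sigma> a e l t \<le> X" if "l \<in> Nk k" for l
          using nb that t \<open>k \<le> n\<close> unfolding net_bounded_def X_def L_def N_def
          by (intro less_imp_le) auto
      qed
      also have "\<dots> \<le> 2 * \<sigma>\<^sup>2 * (E * (1 + ln L)) + 1"
        using X by (intro add_right_mono mult_left_mono) simp_all
      also have "\<dots> \<le> C * (1 + ln L)" using L by (simp add: C_def algebra_simps)
      finally show ?thesis .
    qed
    show ?thesis
      unfolding L_def[symmetric]
    proof (intro exI[of _ N] conjI allI impI N)
      fix a e t
      assume "ucb_path \<beta> \<theta> T a e" "net_bounded \<sigma> T N a e"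
        "\<forall>t\<le>T. (mat_norm (matrix_inv (design a t)) (score a e t))\<^sup>2 \<le> C2 * L" "t \<in> {1..T}"
      then show "(mat_norm (matrix_inv (design a t)) (score a e t))\<^sup>2 \<le> C * (1 + ln L)"
        by (rule main)
    qed
  qed
  then show ?thesis using C by (intro exI[of _ C] conjI allI impI)
qed

lemma ucb_path_error_nets:
  fixes \<sigma> \<beta> :: real
  assumes \<sigma>: "\<sigma> > 0" and \<beta>: "\<beta> > 0"
  shows "\<exists>C>0. \<forall>T\<ge>3. \<forall>\<theta> :: real ^ 'd. norm \<theta> = 1 \<longrightarrow> (\<exists>N1 N2 N3.
    finite N1 \<and> N1 \<noteq> {} \<and> finite N2 \<and> N2 \<noteq> {} \<and> finite N3 \<and> N3 \<noteq> {} \<and>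
    (\<forall>a e t. ucb_path \<beta> \<theta> T a e \<longrightarrow> net_bounded \<sigma> T N1 a e \<longrightarrow> net_bounded \<sigma> T N2 a e \<longrightarrow>
      net_bounded \<sigma> T N3 a e \<longrightarrow> t \<in> {1..T} \<longrightarrow>
      mat_norm (design a t) (ridge a (\<lambda>s. a s \<bullet> \<theta> + e s) t - \<theta>)
        \<le> C * (\<sigma> * sqrt (real CARD('d) + ln (ln (real T))) + 1)))"
proof -
  from polynomial_score_net[of \<sigma>] obtain C1 where C1: "C1 > 0" and n1: "\<forall>T\<ge>3. \<exists>N :: (real ^ 'd) set. finite N \<and> N \<noteq> {} \<and>
    (\<forall>a e t. (\<forall>s\<in>{1..T}. norm (a s) \<le> 1) \<longrightarrow> net_bounded \<sigma> T N a e \<longrightarrow> t \<le> T \<longrightarrow>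
      norm (score a e t) \<le> C1 * real T)"
    by (elim exE conjE)
  from logarithmic_score_net[OF \<sigma> C1] obtain C2 where C2: "C2 > 0" and n2: "\<forall>T\<ge>3. \<exists>N :: (real ^ 'd) set. finite N \<and> N \<noteq> {} \<and>
    (\<forall>a e t. (\<forall>s\<in>{1..T}. norm (a s) \<le> 1) \<longrightarrow> net_bounded \<sigma> T N a e \<longrightarrow> t \<le> T \<longrightarrow>
      norm (score a e t) \<le> C1 * real T \<longrightarrow>
      (mat_norm (matrix_inv (design a t)) (score a e t))\<^sup>2 \<le> C2 * ln (real T))"
    by (elim exE conjE)
  from doubly_logarithmic_score_net[OF \<sigma> \<beta> C2] obtain C3 where C3: "C3 > 0"
    and n3: "\<forall>T\<ge>3. \<forall>\<theta> :: real ^ 'd. norm \<theta> = 1 \<longrightarrow> (\<exists>N. finite N \<and> N \<noteq> {} \<and>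
    (\<forall>a e t. ucb_path \<beta> \<theta> T a e \<longrightarrow> net_bounded \<sigma> T N a e \<longrightarrow>
      (\<forall>t\<le>T. (mat_norm (matrix_inv (design a t)) (score a e t))\<^sup>2 \<le> C2 * ln (real T)) \<longrightarrow>
      t \<in> {1..T} \<longrightarrow>
      (mat_norm (matrix_inv (design a t)) (score a e t))\<^sup>2 \<le> C3 * (1 + ln (ln (real T)))))"
    by (elim exE conjE)
  \<comment> \<open>The claimed bound carries a factor \<open>\<sigma>\<close>, which the division
    compensates. The 1 in 1 + ln ln T is absorbed by the dimension, and the summand 1 of
    \<open>C\<close> takes care of the regularisation bias.\<close>
  define C where "C = sqrt C3 / \<sigma> + 1"
  have C: "C > 0" using C3 \<sigma> by (simp add: C_def add_pos_pos)
  have "\<exists>N1 N2 N3.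
    finite N1 \<and> N1 \<noteq> {} \<and> finite N2 \<and> N2 \<noteq> {} \<and> finite N3 \<and> N3 \<noteq> {} \<and>
    (\<forall>a e t. ucb_path \<beta> \<theta> T a e \<longrightarrow> net_bounded \<sigma> T N1 a e \<longrightarrow> net_bounded \<sigma> T N2 a e \<longrightarrow>
      net_bounded \<sigma> T N3 a e \<longrightarrow> t \<in> {1..T} \<longrightarrow>
      mat_norm (design a t) (ridge a (\<lambda>s. a s \<bullet> \<theta> + e s) t - \<theta>)
        \<le> C * (\<sigma> * sqrt (real CARD('d) + ln (ln (real T))) + 1))"
    if T: "T \<ge> 3" and th: "norm \<theta> = 1" for T and \<theta> :: "real ^ 'd"
  proof -
    obtain N1 :: "(real ^ 'd) set" where N1: "finite N1" "N1 \<noteq> {}" and b1: "\<forall>a e t. (\<forall>s\<in>{1..T}. norm (a s) \<le> 1) \<longrightarrow>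
        net_bounded \<sigma> T N1 a e \<longrightarrow> t \<le> T \<longrightarrow> norm (score a e t) \<le> C1 * real T"
      using n1[rule_format, OF T] by (elim exE conjE)
    obtain N2 :: "(real ^ 'd) set" where N2: "finite N2" "N2 \<noteq> {}" and b2: "\<forall>a e t. (\<forall>s\<in>{1..T}. norm (a s) \<le> 1) \<longrightarrow>
        net_bounded \<sigma> T N2 a e \<longrightarrow> t \<le> T \<longrightarrow> norm (score a e t) \<le> C1 * real T \<longrightarrow>
        (mat_norm (matrix_inv (design a t)) (score a e t))\<^sup>2 \<le> C2 * ln (real T)"
      using n2[rule_format, OF T] by (elim exE conjE)
    obtain N3 where N3: "finite N3" "N3 \<noteq> {}" and b3: "\<forall>a e t. ucb_path \<beta> \<theta> T a e \<longrightarrow>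
        net_bounded \<sigma> T N3 a e \<longrightarrow>
        (\<forall>t\<le>T. (mat_norm (matrix_inv (design a t)) (score a e t))\<^sup>2 \<le> C2 * ln (real T)) \<longrightarrow>
        t \<in> {1..T} \<longrightarrow>
        (mat_norm (matrix_inv (design a t)) (score a e t))\<^sup>2 \<le> C3 * (1 + ln (ln (real T)))"
      using n3[rule_format, OF T th] by (elim exE conjE)
    have main: "mat_norm (design a t) (ridge a (\<lambda>s. a s \<bullet> \<theta> + e s) t - \<theta>)
        \<le> C * (\<sigma> * sqrt (real CARD('d) + ln (ln (real T))) + 1)"
      if p: "ucb_path \<beta> \<theta> T a e" and g1: "net_bounded \<sigma> T N1 a e" and g2: "net_bounded \<sigma> T N2 a e"
        and g3: "net_bounded \<sigma> T N3 a e" and t: "t \<in> {1..T}" for a e t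
    proof -
      have a: "\<forall>s\<in>{1..T}. norm (a s) \<le> 1" using ucb_path_norm_le[OF p] by blast
      have "norm (score a e s) \<le> C1 * real T" if "s \<le> T" for s
        using b1 a g1 that by blast
      then have "\<forall>s\<le>T. (mat_norm (matrix_inv (design a s)) (score a e s))\<^sup>2 \<le> C2 * ln (real T)"
        using b2 a g2 by blast
      then have W: "(mat_norm (matrix_inv (design a t)) (score a e t))\<^sup>2 \<le> C3 * (1 + ln (ln (real T)))"
        using b3 p g3 t by blast
      define S where "S = sqrt (real CARD('d) + ln (ln (real T)))"
      have S0: "S \<ge> 0" unfolding S_def using ln_ge_1[OF T] by simp
      have d: "1 \<le> real CARD('d)" by (simp add: Suc_leI)
      have "mat_norm (matrix_inv (design a t)) (score a e t) \<le> sqrt (C3 * (1 + ln (ln (real T))))"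
        using W by (rule real_le_rsqrt)
      also have "\<dots> \<le> sqrt C3 * S"
        unfolding S_def real_sqrt_mult[symmetric] using C3 d by (intro real_sqrt_le_mono mult_left_mono) simp_all
      finally have "mat_norm (design a t) (ridge a (\<lambda>s. a s \<bullet> \<theta> + e s) t - \<theta>) \<le> sqrt C3 * S + 1"
        using ridge_error_le[OF th, of a t e] by linarith
      also have "\<dots> \<le> C * (\<sigma> * S + 1)"
      proof -
        have "C * (\<sigma> * S + 1) = sqrt C3 * S + \<sigma> * S + sqrt C3 / \<sigma> + 1"
          using \<sigma> by (simp add: C_def field_simps)
        moreover have "0 \<le> \<sigma> * S" "0 \<le> sqrt C3 / \<sigma>" using \<sigma> S0 C3 by simp_all
        ultimately show ?thesis by linarith
      qed
      finally show ?thesis by (simp add: S_def)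
    qed
    show ?thesis
      by (intro exI[of _ N1] exI[of _ N2] exI[of _ N3] conjI allI impI N1 N2 N3 main)
  qed
  then show ?thesis using C by (intro exI[of _ C] conjI allI impI)
qed

section \<open>Measurability and the union bound\<close>

context linucb_ball
begin

lemma design_entry_measurable:
  assumes "t \<le> T"
  shows "(\<lambda>\<omega>. design (\<lambda>s. a s \<omega>) t $ i $ j) \<in> borel_measurable M"
proof -
  have [measurable]: "(\<lambda>\<omega>. a s \<omega> $ i) \<in> borel_measurable M" if "s \<in> {1..t}" for s i
  proof -
    have "a s \<in> borel_measurable M" by (rule action_measurable) (use that assms in auto)
    then have "(\<lambda>\<omega>. a s \<omega> \<bullet> axis i 1) \<in> borel_measurable M" by simp
    then show ?thesis by (simp add: inner_axis)
  qed
  have "design (\<lambda>s. a s \<omega>) t $ i $ j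
      = (if i = j then 1 else 0) + (\<Sum>s\<in>{1..t}. a s \<omega> $ i * a s \<omega> $ j)" for \<omega>
    by (simp add: design_def mat_def outer_def)
  then show ?thesis by simp
qed

text \<open>Cramer's rule writes the ridge estimator as a quotient of polynomials in the data.\<close>

lemma ridge_entry_measurable:
  assumes "t \<le> T"
  shows "(\<lambda>\<omega>. ridge (\<lambda>s. a s \<omega>) (\<lambda>s. reward \<theta> a \<epsilon> s \<omega>) t $ k) \<in> borel_measurable M"
proof -
  let ?D = "\<lambda>\<omega>. design (\<lambda>s. a s \<omega>) t"
  let ?b = "\<lambda>\<omega>. \<Sum>s\<in>{1..t}. reward \<theta> a \<epsilon> s \<omega> *\<^sub>R a s \<omega>"
  have D[measurable]: "(\<lambda>\<omega>. ?D \<omega> $ i $ j) \<in> borel_measurable M" for i j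
    by (rule design_entry_measurable[OF assms])
  have b[measurable]: "(\<lambda>\<omega>. ?b \<omega> $ i) \<in> borel_measurable M" for i
  proof -
    have "reward \<theta> a \<epsilon> s \<in> borel_measurable M" "a s \<in> borel_measurable M" if "s \<in> {1..t}" for s
      using measurable_from_subalg[OF subalgebra_filtration[OF assms]]
        reward_measurable_filtration[OF that] action_measurable_filtration[OF that] by blast+
    then have "?b \<in> borel_measurable M"
      by (intro borel_measurable_sum borel_measurable_scaleR)
    then have "(\<lambda>\<omega>. ?b \<omega> \<bullet> axis i 1) \<in> borel_measurable M" by simp
    then show ?thesis by (simp add: inner_axis)
  qed
  have "ridge (\<lambda>s. a s \<omega>) (\<lambda>s. reward \<theta> a \<epsilon> s \<omega>) t $ k
      = det (\<chi> i j. if j = k then ?b \<omega> $ i else ?D \<omega> $ i $ j) / det (?D \<omega>)" for \<omega>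
  proof -
    have nz: "det (?D \<omega>) \<noteq> 0"
      using above_id_invertible[OF above_id_design] by (simp add: invertible_det_nz)
    have eq: "?D \<omega> *v ridge (\<lambda>s. a s \<omega>) (\<lambda>s. reward \<theta> a \<epsilon> s \<omega>) t = ?b \<omega>"
      by (simp add: ridge_def above_id_inv_mult(1)[OF above_id_design])
    show ?thesis by (subst cramer[OF nz, THEN iffD1, OF eq]) (rule vec_lambda_beta)
  qed
  moreover have "(\<lambda>\<omega>. det (\<chi> i j. if j = k then ?b \<omega> $ i else ?D \<omega> $ i $ j)) \<in> borel_measurable M"
    unfolding det_def
    by (intro borel_measurable_sum borel_measurable_times borel_measurable_prod borel_measurable_const)
      (auto intro: D b)
  moreover have "(\<lambda>\<omega>. det (?D \<omega>)) \<in> borel_measurable M"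
    unfolding det_def
    by (intro borel_measurable_sum borel_measurable_times borel_measurable_prod borel_measurable_const D)
  ultimately show ?thesis by simp
qed

lemma error_measurable:
  assumes "t \<le> T"
  shows "(\<lambda>\<omega>. mat_norm (design (\<lambda>s. a s \<omega>) t)
    (ridge (\<lambda>s. a s \<omega>) (\<lambda>s. reward \<theta> a \<epsilon> s \<omega>) t - \<theta>)) \<in> borel_measurable M"
proof -
  note [measurable] = design_entry_measurable[OF assms] ridge_entry_measurable[OF assms]
  show ?thesis
    unfolding mat_norm_def inner_vec_def matrix_vector_mult_def by simp
qed

lemma path: "\<omega> \<in> space M \<Longrightarrow> ucb_path \<beta> \<theta> T (\<lambda>s. a s \<omega>) (\<lambda>s. \<epsilon> s \<omega>)"
  unfolding ucb_path_def
proof (intro conjI ballI norm_theta)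
  fix t assume \<omega>: "\<omega> \<in> space M" and t: "t \<in> {1..T}"
  then have "t - 1 < T" by auto
  from estimator[OF this \<omega>] action[OF t \<omega>]
  show "\<exists>h. is_projected (ridge (\<lambda>s. a s \<omega>) (\<lambda>s. a s \<omega> \<bullet> \<theta> + \<epsilon> s \<omega>) (t - 1)) h \<and>
      is_arg_max (ucb_index \<beta> h (design (\<lambda>s. a s \<omega>) (t - 1))) (\<lambda>x. x \<in> cball 0 1) (a t \<omega>)"
    unfolding reward_def by blast
qed

lemma net_bounded_prob:
  assumes N: "finite N" "N \<noteq> {}" and T: "T \<ge> 3"
  shows "{\<omega> \<in> space M. \<not> net_bounded \<sigma> T N (\<lambda>s. a s \<omega>) (\<lambda>s. \<epsilon> s \<omega>)} \<in> events"
    and "prob {\<omega> \<in> space M. \<not> net_bounded \<sigma> T N (\<lambda>s. a s \<omega>) (\<lambda>s. \<epsilon> s \<omega>)} \<le> 1 / (3 * ln (real T))"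
proof -
  have "1 / (3 * ln (real T)) > 0" using ln_ge_1[OF T] by simp
  note b = exponent_union_bound[OF N this]
  have "{\<omega> \<in> space M. \<not> net_bounded \<sigma> T N (\<lambda>s. a s \<omega>) (\<lambda>s. \<epsilon> s \<omega>)}
      = {\<omega> \<in> space M. \<exists>l\<in>N. \<exists>t\<le>T. ln (real (card N) / (1 / (3 * ln (real T))))
          \<le> exponent \<sigma> (\<lambda>s. a s \<omega>) (\<lambda>s. \<epsilon> s \<omega>) l t}"
    by (auto simp: net_bounded_def not_less)
  with b show "{\<omega> \<in> space M. \<not> net_bounded \<sigma> T N (\<lambda>s. a s \<omega>) (\<lambda>s. \<epsilon> s \<omega>)} \<in> events"
    "prob {\<omega> \<in> space M. \<not> net_bounded \<sigma> T N (\<lambda>s. a s \<omega>) (\<lambda>s. \<epsilon> s \<omega>)} \<le> 1 / (3 * ln (real T))"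
    by simp_all
qed

end

theorem theorem2:
  fixes \<sigma> \<beta> :: real
  assumes "CARD('d::finite) \<ge> 2" and "\<sigma> > 0" and "\<beta> > 0"
  shows "\<exists>c>0. \<forall>T\<ge>3. \<forall>(M :: 'w measure) (\<theta> :: real ^ 'd) a h \<epsilon>.
    linucb_ball M \<theta> \<sigma> \<beta> T a h \<epsilon> \<longrightarrow>
    measure M {\<omega> \<in> space M.
      (MAX t\<in>{1..T}. mat_norm (design (\<lambda>s. a s \<omega>) t)
         (ridge (\<lambda>s. a s \<omega>) (\<lambda>s. reward \<theta> a \<epsilon> s \<omega>) t - \<theta>))
      \<le> c * (\<sigma> * sqrt (real CARD('d) + ln (ln (real T))) + 1)}
    \<ge> 1 - 1 / ln (real T)"
proof -
  from ucb_path_error_nets[OF assms(2,3)] obtain C where C: "C > 0"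
    and nets: "\<forall>T\<ge>3. \<forall>\<theta> :: real ^ 'd. norm \<theta> = 1 \<longrightarrow> (\<exists>N1 N2 N3.
    finite N1 \<and> N1 \<noteq> {} \<and> finite N2 \<and> N2 \<noteq> {} \<and> finite N3 \<and> N3 \<noteq> {} \<and>
    (\<forall>a e t. ucb_path \<beta> \<theta> T a e \<longrightarrow> net_bounded \<sigma> T N1 a e \<longrightarrow> net_bounded \<sigma> T N2 a e \<longrightarrow>
      net_bounded \<sigma> T N3 a e \<longrightarrow> t \<in> {1..T} \<longrightarrow>
      mat_norm (design a t) (ridge a (\<lambda>s. a s \<bullet> \<theta> + e s) t - \<theta>)
        \<le> C * (\<sigma> * sqrt (real CARD('d) + ln (ln (real T))) + 1)))"
    by (elim exE conjE)
  have main: "measure M {\<omega> \<in> space M.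
      (MAX t\<in>{1..T}. mat_norm (design (\<lambda>s. a s \<omega>) t)
         (ridge (\<lambda>s. a s \<omega>) (\<lambda>s. reward \<theta> a \<epsilon> s \<omega>) t - \<theta>))
      \<le> C * (\<sigma> * sqrt (real CARD('d) + ln (ln (real T))) + 1)}
    \<ge> 1 - 1 / ln (real T)"
    if T: "T \<ge> 3" and run: "linucb_ball M \<theta> \<sigma> \<beta> T a h \<epsilon>"
    for T and M :: "'w measure" and \<theta> :: "real ^ 'd" and a h \<epsilon>
  proof -
    interpret linucb_ball M \<theta> \<sigma> \<beta> T a h \<epsilon> by (rule run)
    obtain N1 N2 N3 where N: "finite N1" "N1 \<noteq> {}" "finite N2" "N2 \<noteq> {}" "finite N3" "N3 \<noteq> {}"
      and bound: "\<forall>a e t. ucb_path \<beta> \<theta> T a e \<longrightarrow> net_bounded \<sigma> T N1 a e \<longrightarrow>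
        net_bounded \<sigma> T N2 a e \<longrightarrow> net_bounded \<sigma> T N3 a e \<longrightarrow> t \<in> {1..T} \<longrightarrow>
        mat_norm (design a t) (ridge a (\<lambda>s. a s \<bullet> \<theta> + e s) t - \<theta>)
          \<le> C * (\<sigma> * sqrt (real CARD('d) + ln (ln (real T))) + 1)"
      using nets[rule_format, OF T norm_theta] by (elim exE conjE)
    let ?x = "C * (\<sigma> * sqrt (real CARD('d) + ln (ln (real T))) + 1)"
    let ?err = "\<lambda>t \<omega>. mat_norm (design (\<lambda>s. a s \<omega>) t)
      (ridge (\<lambda>s. a s \<omega>) (\<lambda>s. reward \<theta> a \<epsilon> s \<omega>) t - \<theta>)"
    let ?bad = "\<lambda>N. {\<omega> \<in> space M. \<not> net_bounded \<sigma> T N (\<lambda>s. a s \<omega>) (\<lambda>s. \<epsilon> s \<omega>)}"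
    let ?good = "{\<omega> \<in> space M. (MAX t\<in>{1..T}. ?err t \<omega>) \<le> ?x}"
    have Max: "(MAX t\<in>{1..T}. ?err t \<omega>) \<le> ?x \<longleftrightarrow> (\<forall>t\<in>{1..T}. ?err t \<omega> \<le> ?x)" for \<omega>
      using T by (subst Max_le_iff) auto
    \<comment> \<open>Outside the sigma-algebra \<open>measure\<close> returns 0, so a lower bound
      on the probability requires that the good set is an event.\<close>
    have good: "?good \<in> events"
    proof -
      have "{\<omega> \<in> space M. \<forall>t\<in>{1..T}. ?err t \<omega> \<le> ?x} \<in> events"
        using error_measurable by (intro sets.sets_Collect_finite_All) auto
      then show ?thesis unfolding Max .
    qed
    note bad = net_bounded_prob[OF N(1,2) T] net_bounded_prob[OF N(3,4) T] net_bounded_prob[OF N(5,6) T]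
    have "space M - ?good \<subseteq> ?bad N1 \<union> ?bad N2 \<union> ?bad N3"
    proof
      fix \<omega> assume \<omega>: "\<omega> \<in> space M - ?good"
      then obtain t where t: "t \<in> {1..T}" "\<not> ?err t \<omega> \<le> ?x" unfolding Max by blast
      then have "\<not> (net_bounded \<sigma> T N1 (\<lambda>s. a s \<omega>) (\<lambda>s. \<epsilon> s \<omega>) \<and>
          net_bounded \<sigma> T N2 (\<lambda>s. a s \<omega>) (\<lambda>s. \<epsilon> s \<omega>) \<and> net_bounded \<sigma> T N3 (\<lambda>s. a s \<omega>) (\<lambda>s. \<epsilon> s \<omega>))"
        using bound[rule_format, OF path] \<omega> unfolding reward_def by blast
      then show "\<omega> \<in> ?bad N1 \<union> ?bad N2 \<union> ?bad N3" using \<omega> by blast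
    qed
    then have "prob (space M - ?good) \<le> prob (?bad N1 \<union> ?bad N2 \<union> ?bad N3)"
      using bad by (intro finite_measure_mono) auto
    also have "\<dots> \<le> prob (?bad N1 \<union> ?bad N2) + prob (?bad N3)"
      using bad by (intro measure_Un_le) auto
    also have "\<dots> \<le> prob (?bad N1) + prob (?bad N2) + prob (?bad N3)"
      using bad by (intro add_right_mono measure_Un_le) auto
    also have "\<dots> \<le> 3 * (1 / (3 * ln (real T)))" using bad by linarith
    also have "\<dots> = 1 / ln (real T)" by simp
    finally show ?thesis using prob_compl[OF good] by simp
  qed
  show ?thesis using C main by (intro exI[of _ C] conjI allI impI)
qed

end
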